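(* Let $q=(\mathcal{G},\sigma)$ be a simple symmetric couple with canonical decomposition $\mathcal{G}=\mathcal{K}\oplus\mathcal{P}$, and let $\mathcal{Z}(\mathcal{K})$ be the centre of $\mathcal{K}$. The map $$\mathcal{Z}(\mathcal{K})\setminus\{0\}\to\mathcal{Z}^2(\mathcal{G}):\ z\mapsto\underline{z}$$ defines a bijection between $\mathcal{Z}(\mathcal{K})\setminus\{0\}$ and the set of $\mathcal{K}$-invariant symplectic forms on $\mathcal{P}$.
   Context: A symmetric couple is a couple $(\mathcal{G},\sigma)$ where $\mathcal{G}$ is a finite-dimensional real Lie algebra and $\sigma$ an involutive automorphism such that, writing $\mathcal{G}=\mathcal{K}\oplus\mathcal{P}$ with $\sigma=\mathrm{id}_{\mathcal{K}}\oplus(-\mathrm{id}_{\mathcal{P}})$ (canonical decomposition), $\mathcal{K}$ acts faithfully on $\mathcal{P}$ and $[\mathcal{P},\mathcal{P}]=\mathcal{K}$. It is simple if $\mathcal{G}$ is a simple Lie algebra. $\beta$ denotes the Killing form of $\mathcal{G}$. For $X\in\mathcal{G}$, $\underline{X}\in\Lambda^2(\mathcal{G})$ is the $2$-form $\underline{X}(Y,Z)=-\beta(X,[Y,Z])$ for $Y,Z\in\mathcal{G}$. $\mathcal{Z}^2(\mathcal{G})$ is the space of Chevalley $2$-cocycles of $\mathcal{G}$ with values in the trivial module $\mathbb{R}$. A $\mathcal{K}$-invariant symplectic form $\Omega$ on $\mathcal{P}$ is identified with its extension $\underline{\Omega}$ to $\mathcal{G}\times\mathcal{G}$ by $0$ on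 $\mathcal{K}$ (which is a $2$-cocycle). *)

theory Defs
  imports "HOL-Analysis.Analysis"
begin

section \<open>Finite-dimensional real Lie algebras\<close>

text \<open>A Lie algebra is a bracket on a real vector space, the latter being a whole type of class
  \<^class>\<open>real_vector\<close>: no topology and no inner product is involved.\<close>

locale lie_algebra =
  fixes br :: "'g::real_vector \<Rightarrow> 'g \<Rightarrow> 'g"
  assumes bilinear_br: "bilinear br"
    and br_self: "br x x = 0"
    and jacobi: "br x (br y z) + br y (br z x) + br z (br x y) = 0"

locale fin_dim_lie_algebra = lie_algebra br
  for br :: "'g::real_vector \<Rightarrow> 'g \<Rightarrow> 'g" +
  assumes finite_dim: "\<exists>B :: 'g set. finite B \<and> span B = UNIV"

definition lie_ideal :: "('g::real_vector \<Rightarrow> 'g \<Rightarrow> 'g) \<Rightarrow> 'g set \<Rightarrow> bool"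
  where "lie_ideal br I \<longleftrightarrow> subspace I \<and> (\<forall>x. \<forall>y\<in>I. br x y \<in> I)"

definition simple_lie_algebra :: "('g::real_vector \<Rightarrow> 'g \<Rightarrow> 'g) \<Rightarrow> bool"
  where "simple_lie_algebra br \<longleftrightarrow>
    lie_algebra br \<and> (\<exists>x y. br x y \<noteq> 0) \<and> (\<forall>I. lie_ideal br I \<longrightarrow> I = {0} \<or> I = UNIV)"

definition lie_centre :: "('g::real_vector \<Rightarrow> 'g \<Rightarrow> 'g) \<Rightarrow> 'g set \<Rightarrow> 'g set"
  where "lie_centre br K = {z \<in> K. \<forall>x\<in>K. br z x = 0}"

text \<open>The trace of an endomorphism is read off in an arbitrary finite basis; the lemma
  \<open>lin_trace_eq\<close> shows that the choice is immaterial.\<close>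

definition lin_trace :: "('v::real_vector \<Rightarrow> 'v) \<Rightarrow> real"
  where "lin_trace f =
    (let B = (SOME B. finite B \<and> independent B \<and> span B = UNIV)
     in \<Sum>b\<in>B. representation B (f b) b)"

lemma basis_trace_unique:
  fixes f :: "'v::real_vector \<Rightarrow> 'v"
  assumes f: "linear f"
    and B: "finite B" "independent B" "span B = UNIV"
    and C: "finite C" "independent C" "span C = UNIV"
  shows "(\<Sum>b\<in>B. representation B (f b) b) = (\<Sum>c\<in>C. representation C (f c) c)"
proof -
  have expand: "representation D (f x) d = (\<Sum>e\<in>E. representation E x e * representation D (f e) d)"
    if "finite D" "independent D" "span D = UNIV" "finite E" "independent E" "span E = UNIV"
    for D E :: "'v set" and x d
  proof -
    have "x = (\<Sum>e\<in>E. representation E x e *\<^sub>R e)"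
      using that by (subst real_vector.sum_representation_eq) auto
    then have "f x = (\<Sum>e\<in>E. representation E x e *\<^sub>R f e)"
      by (metis (no_types, lifting) f linear_scale linear_sum sum.cong)
    then show ?thesis
      using that by (simp add: real_vector.representation_sum real_vector.representation_scale)
  qed
  have change: "representation D y d = (\<Sum>e\<in>E. representation E y e * representation D e d)"
    if "finite D" "independent D" "span D = UNIV" "finite E" "independent E" "span E = UNIV"
    for D E :: "'v set" and y d
  proof -
    have "y = (\<Sum>e\<in>E. representation E y e *\<^sub>R e)"
      using that by (subst real_vector.sum_representation_eq) auto
    then have "representation D y d = representation D (\<Sum>e\<in>E. representation E y e *\<^sub>R e) d"
      by simp
    then show ?thesis
      using that by (simp add: real_vector.representation_sum real_vector.representation_scale)
  qed
  have "(\<Sum>b\<in>B. representation B (f b) b)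
      = (\<Sum>b\<in>B. \<Sum>c\<in>C. representation C b c * representation B (f c) b)"
    using B C by (intro sum.cong refl expand) auto
  also have "\<dots> = (\<Sum>c\<in>C. \<Sum>b\<in>B. representation B (f c) b * representation C b c)"
    by (subst sum.swap) (simp add: mult.commute)
  also have "\<dots> = (\<Sum>c\<in>C. representation C (f c) c)"
    using B C by (intro sum.cong refl change[symmetric]) auto
  finally show ?thesis .
qed

lemma lin_trace_eq:
  fixes f :: "'v::real_vector \<Rightarrow> 'v"
  assumes "linear f" "finite B" "independent B" "span B = UNIV"
  shows "lin_trace f = (\<Sum>b\<in>B. representation B (f b) b)"
proof -
  define C :: "'v set" where "C = (SOME B. finite B \<and> independent B \<and> span B = UNIV)"
  have "finite C \<and> independent C \<and> span C = UNIV"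
    unfolding C_def by (rule someI[of _ B]) (use assms in auto)
  then show ?thesis
    using assms basis_trace_unique[of f C B] by (simp add: lin_trace_def Let_def flip: C_def)
qed

definition killing_form :: "('g::real_vector \<Rightarrow> 'g \<Rightarrow> 'g) \<Rightarrow> 'g \<Rightarrow> 'g \<Rightarrow> real"
  where "killing_form br X Y = lin_trace (br X \<circ> br Y)"

section \<open>Two-forms\<close>

definition two_cocycles :: "('g::real_vector \<Rightarrow> 'g \<Rightarrow> 'g) \<Rightarrow> ('g \<Rightarrow> 'g \<Rightarrow> real) set"
  where "two_cocycles br = {\<omega>. bilinear \<omega> \<and> (\<forall>X. \<omega> X X = 0) \<and>
    (\<forall>X Y Z. \<omega> (br X Y) Z + \<omega> (br Y Z) X + \<omega> (br Z X) Y = 0)}"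

definition underline_form ::
    "('g::real_vector \<Rightarrow> 'g \<Rightarrow> 'g) \<Rightarrow> 'g \<Rightarrow> 'g \<Rightarrow> 'g \<Rightarrow> real"
  where "underline_form br X = (\<lambda>Y Z. - killing_form br X (br Y Z))"

text \<open>A form on a subspace \<open>P\<close> is a function on the whole type of which only the values
  on \<open>P \<times> P\<close> matter.\<close>

definition bilinear_form_on :: "'v::real_vector set \<Rightarrow> ('v \<Rightarrow> 'v \<Rightarrow> real) \<Rightarrow> bool"
  where "bilinear_form_on P \<Omega> \<longleftrightarrow>
    (\<forall>x\<in>P. \<forall>y\<in>P. \<forall>z\<in>P. \<Omega> (x + y) z = \<Omega> x z + \<Omega> y z \<and> \<Omega> z (x + y) = \<Omega> z x + \<Omega> z y) \<and>
    (\<forall>c. \<forall>x\<in>P. \<forall>y\<in>P. \<Omega> (c *\<^sub>R x) y = c * \<Omega> x y \<and> \<Omega> x (c *\<^sub>R y) = c * \<Omega> x y)"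

definition symplectic_form_on :: "'v::real_vector set \<Rightarrow> ('v \<Rightarrow> 'v \<Rightarrow> real) \<Rightarrow> bool"
  where "symplectic_form_on P \<Omega> \<longleftrightarrow>
    bilinear_form_on P \<Omega> \<and> (\<forall>x\<in>P. \<Omega> x x = 0) \<and>
    (\<forall>x\<in>P. (\<forall>y\<in>P. \<Omega> x y = 0) \<longrightarrow> x = 0)"

definition invariant_form_on ::
    "('g::real_vector \<Rightarrow> 'g \<Rightarrow> 'g) \<Rightarrow> 'g set \<Rightarrow> 'g set \<Rightarrow> ('g \<Rightarrow> 'g \<Rightarrow> real) \<Rightarrow> bool"
  where "invariant_form_on br K P \<Omega> \<longleftrightarrow>
    (\<forall>k\<in>K. \<forall>x\<in>P. \<forall>y\<in>P. \<Omega> (br k x) y + \<Omega> x (br k y) = 0)"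

section \<open>Symmetric couples\<close>

definition sym_K :: "('g::real_vector \<Rightarrow> 'g) \<Rightarrow> 'g set"
  where "sym_K \<sigma> = {x. \<sigma> x = x}"

definition sym_P :: "('g::real_vector \<Rightarrow> 'g) \<Rightarrow> 'g set"
  where "sym_P \<sigma> = {x. \<sigma> x = - x}"

locale symmetric_couple = fin_dim_lie_algebra br
  for br :: "'g::real_vector \<Rightarrow> 'g \<Rightarrow> 'g" +
  fixes \<sigma> :: "'g \<Rightarrow> 'g"
  assumes linear_sigma: "linear \<sigma>"
    and sigma_br: "\<sigma> (br x y) = br (\<sigma> x) (\<sigma> y)"
    and sigma_sigma: "\<sigma> (\<sigma> x) = x"
    and faithful: "\<lbrakk>x \<in> sym_K \<sigma>; \<forall>y\<in>sym_P \<sigma>. br x y = 0\<rbrakk> \<Longrightarrow> x = 0"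
    and br_P_P: "span {br x y | x y. x \<in> sym_P \<sigma> \<and> y \<in> sym_P \<sigma>} = sym_K \<sigma>"

definition simple_symmetric_couple ::
    "('g::real_vector \<Rightarrow> 'g \<Rightarrow> 'g) \<Rightarrow> ('g \<Rightarrow> 'g) \<Rightarrow> bool"
  where "simple_symmetric_couple br \<sigma> \<longleftrightarrow> symmetric_couple br \<sigma> \<and> simple_lie_algebra br"

text \<open>The projection onto \<^term>\<open>sym_P \<sigma>\<close> along \<^term>\<open>sym_K \<sigma>\<close>, and the
  extension by zero of a form on \<^term>\<open>sym_P \<sigma>\<close>.\<close>

definition proj_P :: "('g::real_vector \<Rightarrow> 'g) \<Rightarrow> 'g \<Rightarrow> 'g"
  where "proj_P \<sigma> x = (1/2) *\<^sub>R (x - \<sigma> x)"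

definition extend_form ::
    "('g::real_vector \<Rightarrow> 'g) \<Rightarrow> ('g \<Rightarrow> 'g \<Rightarrow> real) \<Rightarrow> 'g \<Rightarrow> 'g \<Rightarrow> real"
  where "extend_form \<sigma> \<Omega> = (\<lambda>X Y. \<Omega> (proj_P \<sigma> X) (proj_P \<sigma> Y))"

definition invariant_symplectic_forms ::
    "('g::real_vector \<Rightarrow> 'g \<Rightarrow> 'g) \<Rightarrow> ('g \<Rightarrow> 'g) \<Rightarrow> ('g \<Rightarrow> 'g \<Rightarrow> real) set"
  where "invariant_symplectic_forms br \<sigma> =
    {\<Omega>. symplectic_form_on (sym_P \<sigma>) \<Omega> \<and> invariant_form_on br (sym_K \<sigma>) (sym_P \<sigma>) \<Omega>}"

lemma (in symmetric_couple) canonical_decomposition: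
  "x - proj_P \<sigma> x \<in> sym_K \<sigma>" "proj_P \<sigma> x \<in> sym_P \<sigma>" "sym_K \<sigma> \<inter> sym_P \<sigma> = {0}"
proof -
  have s: "\<sigma> (proj_P \<sigma> x) = - proj_P \<sigma> x"
    using linear_sigma sigma_sigma
    by (simp add: proj_P_def linear_diff linear_scale flip: scaleR_minus_right)
  then show "proj_P \<sigma> x \<in> sym_P \<sigma>" by (simp add: sym_P_def)
  have "proj_P \<sigma> x + proj_P \<sigma> x = x - \<sigma> x"
    by (simp add: proj_P_def flip: scaleR_add_left)
  then show "x - proj_P \<sigma> x \<in> sym_K \<sigma>"
    using linear_sigma s by (simp add: sym_K_def linear_diff algebra_simps)
  have "x = 0" if "x \<in> sym_K \<sigma> \<inter> sym_P \<sigma>" for x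
    using that by (auto simp: sym_K_def sym_P_def real_vector.scale_minus_right eq_neg_iff_add_eq_0
        simp flip: scaleR_2)
  moreover have "\<sigma> 0 = 0" using linear_sigma by (rule linear_0)
  ultimately show "sym_K \<sigma> \<inter> sym_P \<sigma> = {0}"
    by (auto simp: sym_K_def sym_P_def)
qed

lemma (in symmetric_couple) extend_form_characterization:
  assumes "bilinear_form_on (sym_P \<sigma>) \<Omega>"
  shows "\<lbrakk>X \<in> sym_P \<sigma>; Y \<in> sym_P \<sigma>\<rbrakk> \<Longrightarrow> extend_form \<sigma> \<Omega> X Y = \<Omega> X Y"
    and "X \<in> sym_K \<sigma> \<or> Y \<in> sym_K \<sigma> \<Longrightarrow> extend_form \<sigma> \<Omega> X Y = 0"
proof -
  have P: "proj_P \<sigma> x = x" if "x \<in> sym_P \<sigma>" for x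
    using that by (simp add: proj_P_def sym_P_def flip: scaleR_2)
  show "extend_form \<sigma> \<Omega> X Y = \<Omega> X Y" if "X \<in> sym_P \<sigma>" "Y \<in> sym_P \<sigma>"
    using that P by (simp add: extend_form_def)
  have K: "proj_P \<sigma> x = 0" if "x \<in> sym_K \<sigma>" for x
    using that by (simp add: proj_P_def sym_K_def)
  have z: "\<Omega> 0 y = 0 \<and> \<Omega> y 0 = 0" if "y \<in> sym_P \<sigma>" for y
  proof -
    have "\<Omega> (0 *\<^sub>R y) y = 0 * \<Omega> y y" "\<Omega> y (0 *\<^sub>R y) = 0 * \<Omega> y y"
      using assms that unfolding bilinear_form_on_def by blast+
    then show ?thesis by simp
  qed
  show "extend_form \<sigma> \<Omega> X Y = 0" if "X \<in> sym_K \<sigma> \<or> Y \<in> sym_K \<sigma>"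
    using that K z canonical_decomposition(2) by (auto simp: extend_form_def)
qed

end

theory Submission
  imports Defs "HOL-Computational_Algebra.Fundamental_Theorem_Algebra"
begin

text \<open>Write \<open>\<G> = K \<oplus> P\<close> for the canonical decomposition and \<open>\<beta>\<close> for the Killing form.
The statement rests on two facts.

(1) The Killing form of a simple real Lie algebra is nondegenerate
(\<open>simple_killing_nondegenerate\<close>). The radical of \<open>\<beta>\<close> is an ideal, so the point is that \<open>\<beta>\<close> cannot
vanish identically. Suppose it does. After complexification, let \<open>T = ad x\<close> and let \<open>E\<close> act on the
generalised eigenspace of \<open>T\<close> for \<open>\<lambda>\<close> as the complex conjugate of \<open>\<lambda>\<close>. Brackets add
eigenvalues and conjugation is additive, so \<open>E\<close> is a derivation. For every derivation \<open>E\<close> the trace of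
\<open>ad [a, b] \<circ> E\<close> is \<open>- \<beta>(a, E b) = 0\<close>, and a simple algebra is spanned by brackets, so \<open>tr (T \<circ> E) = 0\<close>. But
this trace is the sum of all \<open>\<bar>\<lambda>\<bar>\<^sup>2\<close>, with multiplicity; hence \<open>T\<close> is nilpotent. By Engel's theorem
(\<open>engel_centre\<close>) a nonzero algebra all of whose \<open>ad x\<close> are nilpotent has a nonzero centre,
which is impossible in a simple algebra.

(2) A nonzero \<open>z\<close> in the centre of \<open>K\<close> acts injectively on \<open>P\<close> (\<open>central_injective\<close>). Put
\<open>S = (ad z)\<^sup>2\<close>. On \<open>P\<close> it commutes with the action of \<open>K\<close> and satisfies \<open>[S x, y] = [x, S y]\<close>; by the Jacobi
identity it is even compatible with the curvature \<open>[[x, y], w]\<close>. Therefore the annihilator of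
\<open>S P\<close> is an ideal. If it is zero, \<open>ad z\<close> is injective on \<open>P\<close>. If it is everything, then
\<open>(ad z)\<^sup>2 = 0\<close>, so \<open>ad z \<circ> ad k\<close> squares to zero for \<open>k\<close> in \<open>K\<close>, which makes \<open>z\<close> orthogonal to
\<open>K\<close>; it is orthogonal to \<open>P\<close> anyway, so \<open>z = 0\<close>.

By invariance of \<open>\<beta>\<close>, the form of \<open>z\<close> is \<open>- \<beta>([z, Y], Z)\<close>. It vanishes on \<open>K\<close> because \<open>z\<close> is
central there, and it is nondegenerate on \<open>P\<close> by (1) and (2). The map is injective
by (1) and the triviality of the centre. Conversely, the extension of an invariant symplectic form is
a cocycle, and by (1) it is \<open>\<beta>(D X, Y)\<close> for a linear \<open>D\<close>; the cocycle identity says that \<open>D\<close> is a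
derivation, so \<open>D = ad d\<close> (\<open>derivation_inner\<close>). As the form vanishes on \<open>K\<close>, the \<open>K\<close>-component
of \<open>d\<close> centralises \<open>K\<close>, and its negative is the element sought.\<close>

section \<open>Traces of endomorphisms over a field\<close>

text \<open>The trace is developed over an arbitrary field, so that the same facts serve a real Lie algebra and
its complexification.\<close>

locale endomorphism_trace = finite_dimensional_vector_space scale Basis
  for scale :: "'a::field \<Rightarrow> 'v::ab_group_add \<Rightarrow> 'v" (infixr \<open>\<cdot>\<close> 75)
    and Basis :: "'v set"
begin

abbreviation endo :: "('v \<Rightarrow> 'v) \<Rightarrow> bool"
  where "endo \<equiv> Vector_Spaces.linear (\<cdot>) (\<cdot>)"

lemma endo_iff: "endo f \<longleftrightarrow> (\<forall>x y. f (x + y) = f x + f y) \<and> (\<forall>c x. f (c \<cdot> x) = c \<cdot> f x)"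
  by (simp add: Vector_Spaces.linear_iff vector_space_axioms)

lemma endo_add: "endo f \<Longrightarrow> f (x + y) = f x + f y"
  and endo_scale: "endo f \<Longrightarrow> f (c \<cdot> x) = c \<cdot> f x"
  by (simp_all add: endo_iff)

lemma endo_zero: "endo f \<Longrightarrow> f 0 = 0"
  by (metis endo_scale scale_zero_left)

lemma endo_diff: "endo f \<Longrightarrow> f (x - y) = f x - f y"
  by (metis endo_add add_diff_cancel_right' diff_add_cancel)

lemma endo_sum: "endo f \<Longrightarrow> f (sum g A) = (\<Sum>a\<in>A. f (g a))"
  by (induction A rule: infinite_finite_induct) (auto simp: endo_zero endo_add)

lemma endo_comp: "endo f \<Longrightarrow> endo g \<Longrightarrow> endo (f \<circ> g)"
  by (simp add: endo_iff)

lemma endo_minus: "endo f \<Longrightarrow> endo g \<Longrightarrow> endo (\<lambda>v. f v - g v)"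
  by (simp add: endo_iff algebra_simps)

lemma endo_funpow: "endo f \<Longrightarrow> endo (f ^^ n)"
  by (induction n) (auto simp: endo_iff)

lemma endo_funpow_zero: "endo f \<Longrightarrow> (f ^^ n) 0 = 0"
  using endo_funpow endo_zero by blast

lemma funpow_vanishes_mono:
  assumes "endo f" "(f ^^ m) v = 0" "m \<le> n"
  shows "(f ^^ n) v = 0"
proof -
  have "(f ^^ n) v = (f ^^ (n - m)) ((f ^^ m) v)"
    using assms(3) by (metis add.commute le_add_diff_inverse comp_apply funpow_add)
  then show ?thesis
    using assms(1,2) by (simp add: endo_funpow_zero)
qed

lemma subspace_preimage_endo: "endo f \<Longrightarrow> subspace U \<Longrightarrow> subspace {v. f v \<in> U}"
  by (simp add: subspace_def endo_zero endo_add endo_scale)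

lemma subspace_kernel_endo: "endo f \<Longrightarrow> subspace {v. f v = 0}"
  by (simp add: subspace_def endo_zero endo_add endo_scale)

lemma representation_expand:
  assumes "endo f"
    and B: "finite B" "independent B" "span B = UNIV"
    and C: "independent C" "span C = UNIV"
  shows "representation C (f x) d = (\<Sum>b\<in>B. representation B x b * representation C (f b) d)"
proof -
  have "x = (\<Sum>b\<in>B. representation B x b \<cdot> b)"
    using B by (subst sum_representation_eq) auto
  then have "f x = (\<Sum>b\<in>B. representation B x b \<cdot> f b)"
    using assms(1) endo_sum endo_scale by (metis (no_types, lifting) sum.cong)
  then show ?thesis
    using C by (simp add: representation_sum representation_scale)
qed

lemma representation_sum_basis:
  assumes "b \<in> Basis"
  shows "representation Basis (\<Sum>b\<in>Basis. c b \<cdot> b) b = c b"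
proof -
  have "representation Basis (\<Sum>b\<in>Basis. c b \<cdot> b) b
      = (\<Sum>b'\<in>Basis. c b' * representation Basis b' b)"
    using independent_Basis span_Basis by (simp add: representation_sum representation_scale)
  also have "\<dots> = (\<Sum>b'\<in>Basis. if b' = b then c b' else 0)"
    using independent_Basis by (intro sum.cong) (auto simp: representation_basis)
  finally show ?thesis using assms finite_Basis by simp
qed

definition basis_trace :: "'v set \<Rightarrow> ('v \<Rightarrow> 'v) \<Rightarrow> 'a"
  where "basis_trace B f = (\<Sum>b\<in>B. representation B (f b) b)"

abbreviation trace :: "('v \<Rightarrow> 'v) \<Rightarrow> 'a"
  where "trace \<equiv> basis_trace Basis"

lemma basis_trace_cong_basis:
  assumes f: "endo f"
    and B: "finite B" "independent B" "span B = UNIV"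
    and C: "finite C" "independent C" "span C = UNIV"
  shows "basis_trace B f = basis_trace C f"
proof -
  have "basis_trace B f = (\<Sum>b\<in>B. \<Sum>c\<in>C. representation C b c * representation B (f c) b)"
    unfolding basis_trace_def by (intro sum.cong refl representation_expand f C B(2,3))
  also have "\<dots> = (\<Sum>c\<in>C. \<Sum>b\<in>B. representation B (f c) b * representation C b c)"
    by (subst sum.swap) (simp add: mult.commute)
  also have "\<dots> = basis_trace C f"
    unfolding basis_trace_def
    by (intro sum.cong refl representation_expand[of "\<lambda>x. x", symmetric] B C(2,3))
      (simp add: endo_iff)
  finally show ?thesis .
qed

lemma trace_eq_basis_trace:
  assumes "endo f" "independent B" "span B = UNIV"
  shows "trace f = basis_trace B f"
  using assms finite_Basis independent_Basis span_Basis finiteI_independent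
  by (intro basis_trace_cong_basis) auto

lemma trace_comp_commute:
  assumes "endo f" "endo g"
  shows "trace (f \<circ> g) = trace (g \<circ> f)"
proof -
  note B = finite_Basis independent_Basis span_Basis
  have "trace (f \<circ> g) = (\<Sum>b\<in>Basis. \<Sum>c\<in>Basis. representation Basis (g b) c * representation Basis (f c) b)"
    by (simp add: basis_trace_def representation_expand[OF assms(1) B B(2,3), of "g _"])
  also have "\<dots> = (\<Sum>c\<in>Basis. \<Sum>b\<in>Basis. representation Basis (f c) b * representation Basis (g b) c)"
    by (subst sum.swap) (simp add: mult.commute)
  also have "\<dots> = trace (g \<circ> f)"
    by (simp add: basis_trace_def representation_expand[OF assms(2) B B(2,3), of "f _"])
  finally show ?thesis .
qed

lemma trace_add: "trace (\<lambda>v. f v + g v) = trace f + trace g"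
  and trace_diff: "trace (\<lambda>v. f v - g v) = trace f - trace g"
  and trace_scale: "trace (\<lambda>v. c \<cdot> f v) = c * trace f"
  by (simp_all add: basis_trace_def independent_Basis span_Basis representation_add
      representation_diff representation_scale sum.distrib sum_subtractf sum_distrib_left)

lemma representation_eq_zero_outside:
  assumes "independent B" "C \<subseteq> B" "v \<in> span C" "b \<notin> C"
  shows "representation B v b = 0"
  using assms representation_extend[of B v C] representation_ne_zero by metis

text \<open>In a basis that extends one of the kernel, the image of every basis vector lies in the span of the
kernel part; so all diagonal entries vanish.\<close>

lemma trace_square_zero:
  assumes f: "endo f" and ff: "\<And>v. f (f v) = 0"
  shows "trace f = 0"
proof -
  let ?ker = "{v. f v = 0}"
  obtain C where C: "C \<subseteq> ?ker" "independent C" "?ker \<subseteq> span C"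
    using maximal_independent_subset by metis
  then obtain B where B: "C \<subseteq> B" "independent B" "UNIV \<subseteq> span B"
    using maximal_independent_subset_extend[of C UNIV] by auto
  have "representation B (f b) b = 0" if "b \<in> B" for b
  proof (cases "b \<in> C")
    case True
    then show ?thesis using C(1) by (auto simp: representation_zero)
  next
    case False
    have "f b \<in> span C" using ff C(3) by auto
    with False show ?thesis using B C by (intro representation_eq_zero_outside) auto
  qed
  then show ?thesis
    using trace_eq_basis_trace[OF f B(2)] B(3) by (auto simp: basis_trace_def)
qed

end

section \<open>Generalised eigenvectors of a complex endomorphism\<close>

locale complex_endomorphism = endomorphism_trace scale Basis
  for scale :: "complex \<Rightarrow> 'v::ab_group_add \<Rightarrow> 'v" (infixr \<open>\<cdot>\<close> 75)
    and Basis :: "'v set" +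
  fixes T :: "'v \<Rightarrow> 'v"
  assumes endo_T: "endo T"
begin

definition shift :: "complex \<Rightarrow> 'v \<Rightarrow> 'v"
  where "shift l v = T v - l \<cdot> v"

text \<open>The stages of the generalised eigenspace are kept apart because inductions run over the exponent.\<close>

definition gen_kernel :: "nat \<Rightarrow> complex \<Rightarrow> 'v set"
  where "gen_kernel n l = {v. (shift l ^^ n) v = 0}"

definition gen_eigenspace :: "complex \<Rightarrow> 'v set"
  where "gen_eigenspace l = (\<Union>n. gen_kernel n l)"

lemma endo_shift: "endo (shift l)"
  using endo_T by (simp add: endo_iff shift_def algebra_simps)

lemma shift_change: "shift l v = shift m v + (m - l) \<cdot> v"
  by (simp add: shift_def algebra_simps)

lemma subspace_gen_kernel: "subspace (gen_kernel n l)"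
  unfolding gen_kernel_def by (intro subspace_kernel_endo endo_funpow endo_shift)

lemma gen_kernel_mono: "m \<le> n \<Longrightarrow> gen_kernel m l \<subseteq> gen_kernel n l"
  using funpow_vanishes_mono[OF endo_shift] by (auto simp: gen_kernel_def)

lemma gen_kernel_0: "gen_kernel 0 l = {0}"
  by (simp add: gen_kernel_def)

lemma gen_kernel_Suc: "v \<in> gen_kernel (Suc n) l \<longleftrightarrow> shift l v \<in> gen_kernel n l"
  by (simp add: gen_kernel_def funpow_swap1)

lemma subspace_gen_eigenspace: "subspace (gen_eigenspace l)"
proof (rule subspaceI)
  show "0 \<in> gen_eigenspace l"
    unfolding gen_eigenspace_def using subspace_gen_kernel subspace_0 by blast
  fix v w c assume v: "v \<in> gen_eigenspace l"
  then obtain m where m: "v \<in> gen_kernel m l" by (auto simp: gen_eigenspace_def)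
  show "c \<cdot> v \<in> gen_eigenspace l"
    unfolding gen_eigenspace_def using m subspace_gen_kernel subspace_scale by blast
  assume "w \<in> gen_eigenspace l"
  then obtain n where "w \<in> gen_kernel n l" by (auto simp: gen_eigenspace_def)
  with m have "v \<in> gen_kernel (max m n) l" "w \<in> gen_kernel (max m n) l"
    using gen_kernel_mono max.cobounded1 max.cobounded2 by blast+
  then show "v + w \<in> gen_eigenspace l"
    unfolding gen_eigenspace_def using subspace_gen_kernel subspace_add by blast
qed

lemma shift_gen_eigenspace:
  assumes "v \<in> gen_eigenspace m" shows "shift l v \<in> gen_eigenspace m"
proof -
  obtain n where "(shift m ^^ n) v = 0"
    using assms by (auto simp: gen_eigenspace_def gen_kernel_def)
  then have "shift m v \<in> gen_eigenspace m"
    using gen_kernel_mono[of n "Suc n" m] 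
    by (auto simp: gen_eigenspace_def gen_kernel_Suc[symmetric] gen_kernel_def[of n] subset_iff)
  then show ?thesis
    using assms subspace_gen_eigenspace subspace_add subspace_scale shift_change[of l v m] by metis
qed

text \<open>On the generalised eigenspace for \<open>m\<close>, \<open>T - l\<close> is the nonzero scalar \<open>m - l\<close> plus a nilpotent map.
A solution \<open>u'\<close> for the right-hand side \<open>(T - m) w\<close>, which lies one stage lower, yields the
solution \<open>(w - u') / (m - l)\<close> for \<open>w\<close>.\<close>

lemma shift_surj_gen_eigenspace:
  assumes "m \<noteq> l" "w \<in> gen_eigenspace m"
  shows "\<exists>u \<in> gen_eigenspace m. shift l u = w"
proof -
  have "\<exists>u \<in> gen_kernel n m. shift l u = w" if "w \<in> gen_kernel n m" for n w
    using that
  proof (induction n arbitrary: w)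
    case 0
    then show ?case by (auto simp: gen_kernel_0 endo_zero endo_shift)
  next
    case (Suc n)
    then obtain u' where u': "u' \<in> gen_kernel n m" "shift l u' = shift m w"
      by (auto simp: gen_kernel_Suc)
    define u where "u = inverse (m - l) \<cdot> (w - u')"
    have "u' \<in> gen_kernel (Suc n) m"
      using u'(1) gen_kernel_mono[of n "Suc n"] by auto
    then have "u \<in> gen_kernel (Suc n) m"
      unfolding u_def using Suc.prems subspace_gen_kernel subspace_diff subspace_scale by metis
    moreover have "shift l (w - u') = (m - l) \<cdot> w"
      using u'(2) shift_change[of l w m] by (simp add: endo_diff endo_shift)
    then have "shift l u = w"
      using assms(1) by (simp add: u_def endo_scale endo_shift)
    ultimately show ?case by auto
  qed
  with assms(2) show ?thesis
    unfolding gen_eigenspace_def by blast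
qed

lemma shift_inj_gen_eigenspace:
  assumes "m \<noteq> l" "u \<in> gen_eigenspace m" "(shift l ^^ k) u = 0"
  shows "u = 0"
proof -
  have one: "u = 0" if "u \<in> gen_eigenspace m" "shift l u = 0" for u
  proof -
    have "shift m u = (l - m) \<cdot> u"
      using shift_change[of m u l] that(2) by simp
    then have "(shift m ^^ n) u = (l - m) ^ n \<cdot> u" for n
      by (induction n) (auto simp: endo_scale endo_shift mult.commute)
    then show "u = 0"
      using that(1) assms(1) by (auto simp: gen_eigenspace_def gen_kernel_def)
  qed
  show ?thesis
    using assms(2,3)
  proof (induction k arbitrary: u)
    case (Suc k)
    then have "shift l u = 0"
      using shift_gen_eigenspace by (simp add: funpow_swap1)
    with one Suc.prems show ?case by auto
  qed auto
qed

lemma gen_eigenspaces_independent: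
  assumes "finite M" "\<And>m. m \<in> M \<Longrightarrow> v m \<in> gen_eigenspace m" "(\<Sum>m\<in>M. v m) = 0" "m \<in> M"
  shows "v m = 0"
  using assms
proof (induction M arbitrary: v m rule: finite_induct)
  case (insert l M)
  obtain k where k: "(shift l ^^ k) (v l) = 0"
    using insert.prems(1)[of l] by (auto simp: gen_eigenspace_def gen_kernel_def)
  have e: "endo (shift l ^^ k)" by (intro endo_funpow endo_shift)
  have "(\<Sum>m\<in>M. (shift l ^^ k) (v m)) = (shift l ^^ k) (\<Sum>m\<in>insert l M. v m)"
    using insert.hyps k by (simp add: endo_add endo_sum e)
  then have sum0: "(\<Sum>m\<in>M. (shift l ^^ k) (v m)) = 0"
    using insert.prems(2) e by (simp add: endo_zero)
  have pow: "(shift l ^^ j) w \<in> gen_eigenspace m" if "w \<in> gen_eigenspace m" for j w m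
    using that by (induction j) (auto intro: shift_gen_eigenspace)
  have M: "v m = 0" if "m \<in> M" for m
  proof -
    have "(shift l ^^ k) (v m) = 0"
      using insert.IH[of "\<lambda>m. (shift l ^^ k) (v m)"] sum0 that insert.prems(1) pow by auto
    then show ?thesis
      using shift_inj_gen_eigenspace[of m l "v m" k] that insert.hyps(2) insert.prems(1) by auto
  qed
  then have "v l = 0" using insert.prems(2) insert.hyps by simp
  with M insert.prems(3) show ?case by auto
qed simp

text \<open>If \<open>(T - l) v\<close> is a sum of generalised eigenvectors, its components for eigenvalues other than \<open>l\<close>
have preimages under \<open>T - l\<close> of the same kind. Subtracting these from \<open>v\<close> leaves a vector
that \<open>T - l\<close> sends into the generalised eigenspace for \<open>l\<close>.\<close>

lemma in_span_gen_eigenspaces_if_shift: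
  assumes "shift l v \<in> span (\<Union>m. gen_eigenspace m)"
  shows "v \<in> span (\<Union>m. gen_eigenspace m)"
proof -
  let ?W = "span (\<Union>m. gen_eigenspace m)"
  have "\<exists>u\<in>?W. \<exists>w\<in>gen_eigenspace l. x = shift l u + w" if "x \<in> ?W" for x
    using that
  proof (induction rule: span_induct_alt)
    case base
    show ?case
      using subspace_gen_eigenspace[of l] subspace_0 span_zero endo_zero[OF endo_shift]
      by (metis add.right_neutral)
  next
    case (step c x y)
    then obtain u w where uw: "u \<in> ?W" "w \<in> gen_eigenspace l" "y = shift l u + w" by auto
    obtain m where m: "x \<in> gen_eigenspace m" using step by auto
    show ?case
    proof (cases "m = l")
      case True
      then have "c \<cdot> x + w \<in> gen_eigenspace l"
        using uw m subspace_gen_eigenspace subspace_add subspace_scale by metis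
      then show ?thesis using uw by (intro bexI[of _ u] bexI[of _ "c \<cdot> x + w"]) (auto simp: algebra_simps)
    next
      case False
      then obtain u' where u': "u' \<in> gen_eigenspace m" "shift l u' = x"
        using shift_surj_gen_eigenspace m by blast
      have "c \<cdot> u' + u \<in> ?W"
        using u' uw by (intro span_add span_scale) (auto intro: span_base)
      moreover have "c \<cdot> x + y = shift l (c \<cdot> u' + u) + w"
        using uw u' by (simp add: endo_add endo_scale endo_shift)
      ultimately show ?thesis using uw(2) by blast
    qed
  qed
  then obtain u w where uw: "u \<in> ?W" "w \<in> gen_eigenspace l" "shift l v = shift l u + w"
    using assms by blast
  then have "shift l (v - u) \<in> gen_eigenspace l"
    by (simp add: endo_diff endo_shift)
  then have "v - u \<in> gen_eigenspace l"
    by (auto simp: gen_eigenspace_def gen_kernel_Suc[symmetric])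
  then have "u + (v - u) \<in> ?W"
    by (intro span_add uw) (auto intro: span_base)
  then show ?thesis by simp
qed

definition poly_apply :: "complex poly \<Rightarrow> 'v \<Rightarrow> 'v"
  where "poly_apply p v = (\<Sum>i\<le>degree p. coeff p i \<cdot> (T ^^ i) v)"

lemma poly_apply_bound:
  assumes "degree p \<le> n" shows "poly_apply p v = (\<Sum>i\<le>n. coeff p i \<cdot> (T ^^ i) v)"
  unfolding poly_apply_def using assms
  by (intro sum.mono_neutral_left) (auto simp: coeff_eq_0)

lemma poly_apply_linear_factor: "poly_apply ([:- l, 1:] * q) v = poly_apply q (shift l v)"
proof -
  let ?n = "degree q"
  have d: "degree ([:- l, 1:] * q) \<le> Suc ?n"
    using degree_mult_le[of "[:- l, 1:]" q] by simp
  have c: "coeff ([:- l, 1:] * q) i = (if i = 0 then 0 else coeff q (i - 1)) - l * coeff q i" for i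
    by (cases i) (auto simp: mult_pCons_left)
  have "poly_apply ([:- l, 1:] * q) v
      = (\<Sum>i\<le>Suc ?n. (if i = 0 then 0 else coeff q (i - 1)) \<cdot> (T ^^ i) v)
        - (\<Sum>i\<le>Suc ?n. (l * coeff q i) \<cdot> (T ^^ i) v)"
    unfolding poly_apply_bound[OF d] c by (simp only: scale_left_diff_distrib sum_subtractf)
  also have "(\<Sum>i\<le>Suc ?n. (if i = 0 then 0 else coeff q (i - 1)) \<cdot> (T ^^ i) v)
      = (\<Sum>i\<le>?n. coeff q i \<cdot> (T ^^ i) (T v))"
    by (subst sum.atMost_Suc_shift) (simp add: funpow_swap1)
  also have "(\<Sum>i\<le>Suc ?n. (l * coeff q i) \<cdot> (T ^^ i) v) = (\<Sum>i\<le>?n. (l * coeff q i) \<cdot> (T ^^ i) v)"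
    by (simp add: coeff_eq_0)
  also have "(\<Sum>i\<le>?n. coeff q i \<cdot> (T ^^ i) (T v)) - (\<Sum>i\<le>?n. (l * coeff q i) \<cdot> (T ^^ i) v)
      = poly_apply q (shift l v)"
    using endo_funpow[OF endo_T]
    by (simp add: poly_apply_def shift_def endo_diff endo_scale scale_right_diff_distrib
        sum_subtractf mult.commute)
  finally show ?thesis .
qed

lemma in_span_gen_eigenspaces_if_poly:
  assumes "p \<noteq> 0" "poly_apply p v = 0"
  shows "v \<in> span (\<Union>m. gen_eigenspace m)"
  using assms
proof (induction "degree p" arbitrary: p v)
  case 0
  then obtain a where "p = [:a:]" by (metis degree_eq_zeroE)
  with 0 show ?case by (auto simp: poly_apply_def span_zero)
next
  case (Suc n)
  have "\<not> constant (poly p)"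
    using Suc.hyps(2) by (simp add: constant_degree)
  then obtain l where "poly p l = 0"
    using fundamental_theorem_of_algebra by blast
  then obtain q where q: "p = [:- l, 1:] * q"
    using poly_eq_0_iff_dvd by (metis dvdE)
  then have "q \<noteq> 0" "degree q = n"
    using Suc by (auto simp: degree_mult_eq simp del: mult_pCons_left)
  then have "shift l v \<in> span (\<Union>m. gen_eigenspace m)"
    using Suc q by (auto simp: poly_apply_linear_factor simp del: mult_pCons_left)
  then show ?case by (rule in_span_gen_eigenspaces_if_shift)
qed

text \<open>The vectors \<open>T\<^sup>i v\<close> for \<open>i \<le> dim\<close> satisfy a linear relation, so a nonzero polynomial in \<open>T\<close>
kills \<open>v\<close>; the fundamental theorem of algebra lets its linear factors be stripped off one at a time.\<close>

lemma span_gen_eigenspaces: "span (\<Union>m. gen_eigenspace m) = UNIV"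
proof -
  have "v \<in> span (\<Union>m. gen_eigenspace m)" for v
  proof -
    let ?f = "\<lambda>i. (T ^^ i) v"
    let ?n = "card Basis"
    have "\<exists>c :: nat \<Rightarrow> complex. (\<exists>i\<le>?n. c i \<noteq> 0) \<and> (\<Sum>i\<le>?n. c i \<cdot> ?f i) = 0"
    proof (cases "inj_on ?f {..?n}")
      case True
      have "dependent (?f ` {..?n})"
        using independent_span_bound[of Basis "?f ` {..?n}"] finite_Basis span_Basis True
        by (auto simp: card_image)
      then obtain u where u: "\<exists>w\<in>?f ` {..?n}. u w \<noteq> 0" "(\<Sum>w\<in>?f ` {..?n}. u w \<cdot> w) = 0"
        by (auto simp: dependent_finite)
      then show ?thesis
        using True by (intro exI[of _ "\<lambda>i. u (?f i)"]) (auto simp: sum.reindex)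
    next
      case False
      then obtain i j where ij: "i \<le> ?n" "j \<le> ?n" "i \<noteq> j" "?f i = ?f j"
        by (auto simp: inj_on_def)
      let ?c = "\<lambda>k. if k = i then 1 else if k = j then -1 else (0::complex)"
      have "(\<Sum>k\<le>?n. ?c k \<cdot> ?f k) = (\<Sum>k\<in>{i,j}. ?c k \<cdot> ?f k)"
        using ij by (intro sum.mono_neutral_right) auto
      also have "\<dots> = 0" using ij by simp
      finally show ?thesis using ij by (intro exI[of _ ?c]) auto
    qed
    then obtain c :: "nat \<Rightarrow> complex" and i
      where c: "i \<le> ?n" "c i \<noteq> 0" "(\<Sum>i\<le>?n. c i \<cdot> ?f i) = 0" by blast
    define p where "p = (\<Sum>i\<le>?n. monom (c i) i)"
    have co: "coeff p k = (if k \<le> ?n then c k else 0)" for k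
      by (auto simp: p_def coeff_sum)
    have "degree p \<le> ?n" by (rule degree_le) (simp add: co)
    then have "poly_apply p v = 0"
      using c(3) by (simp add: poly_apply_bound co)
    moreover have "p \<noteq> 0" using c co by (metis coeff_0)
    ultimately show ?thesis by (rule in_span_gen_eigenspaces_if_poly[rotated])
  qed
  then show ?thesis by auto
qed

text \<open>A substitute for the Jordan normal form that is good enough to read off traces. Bases are built along
the increasing union of the kernels of \<open>(T - l)\<^sup>n\<close> over all \<open>l\<close>: a vector added at stage
\<open>n + 1\<close> is sent by \<open>T - l\<close> into the span of the basis of stage \<open>n\<close>.\<close>

lemma triangular_eigenbasis:
  obtains B lam where "independent B" "span B = UNIV"
    "\<And>b. b \<in> B \<Longrightarrow> b \<in> gen_eigenspace (lam b)"
    "\<And>b. b \<in> B \<Longrightarrow> shift (lam b) b \<in> span (B - {b})"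
proof -
  let ?ok = "\<lambda>B b. \<exists>l. b \<in> gen_eigenspace l \<and> shift l b \<in> span (B - {b})"
  have ex: "\<exists>B. independent B \<and> (\<Union>l. gen_kernel n l) \<subseteq> span B \<and> (\<forall>b\<in>B. ?ok B b)" for n
  proof (induction n)
    case 0
    show ?case by (intro exI[of _ "{}"]) (auto simp: gen_kernel_0 span_zero independent_empty)
  next
    case (Suc n)
    then obtain C where C: "independent C" "(\<Union>l. gen_kernel n l) \<subseteq> span C" "\<forall>b\<in>C. ?ok C b"
      by auto
    obtain B where B: "C \<subseteq> B" "B \<subseteq> C \<union> (\<Union>l. gen_kernel (Suc n) l)" "independent B"
        "C \<union> (\<Union>l. gen_kernel (Suc n) l) \<subseteq> span B"
      using maximal_independent_subset_extend[of C "C \<union> (\<Union>l. gen_kernel (Suc n) l)"] C(1) by auto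
    have "?ok B b" if b: "b \<in> B" for b
    proof (cases "b \<in> C")
      case True
      then obtain l where l: "b \<in> gen_eigenspace l" "shift l b \<in> span (C - {b})" using C(3) by auto
      moreover have "span (C - {b}) \<subseteq> span (B - {b})" using B(1) by (intro span_mono) auto
      ultimately show ?thesis by auto
    next
      case False
      then obtain l where l: "b \<in> gen_kernel (Suc n) l" using B(2) b by blast
      then have "shift l b \<in> span C" using C(2) by (auto simp: gen_kernel_Suc)
      moreover have "span C \<subseteq> span (B - {b})" using B(1) False by (intro span_mono) auto
      ultimately show ?thesis using l by (auto simp: gen_eigenspace_def)
    qed
    then show ?case using B by (intro exI[of _ B]) auto
  qed
  have mono: "span (\<Union>l. gen_kernel m l) \<subseteq> span (\<Union>l. gen_kernel n l)" if "m \<le> n" for m n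
    using gen_kernel_mono[OF that] by (intro span_mono) blast
  have "\<exists>n. v \<in> span (\<Union>l. gen_kernel n l)" for v
  proof -
    have "v \<in> span (\<Union>m. gen_eigenspace m)" by (simp add: span_gen_eigenspaces)
    then show ?thesis
    proof (induction rule: span_induct_alt)
      case base
      show ?case by (auto simp: span_zero)
    next
      case (step c x y)
      then obtain m n l where "x \<in> gen_kernel m l" and y: "y \<in> span (\<Union>l. gen_kernel n l)"
        by (auto simp: gen_eigenspace_def)
      then have "x \<in> span (\<Union>l. gen_kernel m l)" by (blast intro: span_base)
      with y have "x \<in> span (\<Union>l. gen_kernel (max m n) l)" "y \<in> span (\<Union>l. gen_kernel (max m n) l)"
        using mono max.cobounded1 max.cobounded2 by blast+
      then show ?case by (blast intro: span_add span_scale)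
    qed
  qed
  then obtain n where n: "\<And>v. v \<in> span (\<Union>l. gen_kernel (n v) l)" by metis
  define N where "N = Max (n ` Basis)"
  have "Basis \<subseteq> span (\<Union>l. gen_kernel N l)"
    using n mono[of "n _" N] finite_Basis by (force simp: N_def)
  then have N: "span (\<Union>l. gen_kernel N l) = UNIV"
    using span_Basis by (metis span_mono span_span top.extremum_uniqueI)
  obtain B where B: "independent B" "(\<Union>l. gen_kernel N l) \<subseteq> span B" "\<forall>b\<in>B. ?ok B b"
    using ex by blast
  moreover have "span B = UNIV"
    using N B(2) by (metis span_mono span_span top.extremum_uniqueI)
  ultimately show ?thesis using that by metis
qed

end

section \<open>Lie algebras over a field\<close>

locale lie_algebra_over = endomorphism_trace scale Basis
  for scale :: "'a::field \<Rightarrow> 'v::ab_group_add \<Rightarrow> 'v" (infixr \<open>\<cdot>\<close> 75)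
    and Basis :: "'v set" +
  fixes br :: "'v \<Rightarrow> 'v \<Rightarrow> 'v"
  assumes br_add_left: "br (x + y) z = br x z + br y z"
    and br_add_right: "br z (x + y) = br z x + br z y"
    and br_scale_left: "br (c \<cdot> x) y = c \<cdot> br x y"
    and br_scale_right: "br x (c \<cdot> y) = c \<cdot> br x y"
    and br_alternating: "br x x = 0"
    and br_jacobi: "br x (br y z) + br y (br z x) + br z (br x y) = 0"
begin

lemma br_anti: "br x y = - br y x"
proof -
  have "br (x + y) (x + y) = br x x + br x y + (br y x + br y y)"
    by (simp only: br_add_left br_add_right) (simp add: algebra_simps)
  then show ?thesis by (simp add: br_alternating eq_neg_iff_add_eq_0)
qed

lemma endo_ad: "endo (br x)"
  by (simp add: endo_iff br_add_right br_scale_right)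

lemma endo_br_right: "endo (\<lambda>x. br x y)"
  by (simp add: endo_iff br_add_left br_scale_left)

lemma br_zero [simp]: "br 0 x = 0" "br x 0 = 0"
  using endo_zero[OF endo_ad] endo_zero[OF endo_br_right] by auto

lemma br_diff: "br (x - y) z = br x z - br y z" "br z (x - y) = br z x - br z y"
  using endo_diff[OF endo_ad] endo_diff[OF endo_br_right] by auto

lemma br_uminus: "br (- x) y = - br x y" "br x (- y) = - br x y"
  using br_diff(1)[of 0 x y] br_diff(2)[of x 0 y] by simp_all

lemma ad_derivation: "br x (br y z) = br (br x y) z + br y (br x z)"
proof -
  have "br z (br x y) = - br (br x y) z" "br y (br z x) = - br y (br x z)"
    using br_anti[of z] br_uminus(2) by metis+
  with br_jacobi[of x y z] show ?thesis by (simp add: algebra_simps)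
qed

lemma ad_br: "br (br x y) = (\<lambda>v. (br x \<circ> br y) v - (br y \<circ> br x) v)"
proof
  show "br (br x y) v = (br x \<circ> br y) v - (br y \<circ> br x) v" for v
    unfolding comp_apply ad_derivation[of x y v] by simp
qed

lemma jacobi_left: "br (br x y) z + br (br y z) x + br (br z x) y = 0"
proof -
  have "br (br x y) z + br (br y z) x + br (br z x) y
      = - (br x (br y z) + br y (br z x) + br z (br x y))"
    using br_anti[of "br x y" z] br_anti[of "br y z" x] br_anti[of "br z x" y] by simp
  then show ?thesis by (simp only: br_jacobi) simp
qed

definition derivation :: "('v \<Rightarrow> 'v) \<Rightarrow> bool"
  where "derivation D \<longleftrightarrow> endo D \<and> (\<forall>x y. D (br x y) = br (D x) y + br x (D y))"

definition killing :: "'v \<Rightarrow> 'v \<Rightarrow> 'a"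
  where "killing x y = trace (br x \<circ> br y)"

lemma killing_commute: "killing x y = killing y x"
  unfolding killing_def by (intro trace_comp_commute endo_ad)

lemma killing_add_left: "killing (x + y) z = killing x z + killing y z"
  unfolding killing_def by (simp add: br_add_left comp_def trace_add)

lemma killing_scale_left: "killing (c \<cdot> x) z = c * killing x z"
  unfolding killing_def by (simp add: br_scale_left comp_def trace_scale)

lemma killing_add_right: "killing z (x + y) = killing z x + killing z y"
  and killing_scale_right: "killing z (c \<cdot> x) = c * killing z x"
  by (simp_all add: killing_commute[of z] killing_add_left killing_scale_left)

lemma killing_diff_left: "killing (x - y) z = killing x z - killing y z"
  using killing_add_left[of "x - y" y z] by simp

lemma killing_zero: "killing 0 x = 0" "killing x 0 = 0"
  using killing_scale_left[of 0 0 x] killing_scale_right[of x 0 0] by auto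

text \<open>Expanding \<open>ad [a, b]\<close> as a commutator and moving \<open>ad b\<close> around the trace leaves
\<open>- tr (ad a \<circ> [E, ad b])\<close>, and \<open>[E, ad b] = ad (E b)\<close> when \<open>E\<close> is a derivation. For inner \<open>E\<close> this
is the invariance of the Killing form.\<close>

lemma trace_derivation_br:
  assumes E: "endo E"
    and comm: "\<And>v. E (br b v) = br (E b) v + br b (E v)"
  shows "trace (br (br a b) \<circ> E) = - killing a (E b)"
proof -
  have *: "trace (br b \<circ> br a \<circ> E) = trace (br a \<circ> E \<circ> br b)"
    using trace_comp_commute[of "br b" "br a \<circ> E"] endo_ad endo_comp[OF endo_ad E]
    by (simp add: comp_assoc)
  have "br (br a b) \<circ> E = (\<lambda>v. (br a \<circ> br b \<circ> E) v - (br b \<circ> br a \<circ> E) v)"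
    by (simp add: ad_br comp_def)
  then have "trace (br (br a b) \<circ> E) = trace (br a \<circ> br b \<circ> E) - trace (br a \<circ> E \<circ> br b)"
    using * by (simp only: trace_diff)
  also have "\<dots> = trace (\<lambda>v. (br a \<circ> br b \<circ> E) v - (br a \<circ> E \<circ> br b) v)"
    by (simp only: trace_diff)
  also have "(\<lambda>v. (br a \<circ> br b \<circ> E) v - (br a \<circ> E \<circ> br b) v) = (\<lambda>v. (-1) \<cdot> (br a \<circ> br (E b)) v)"
    by (rule ext) (simp add: comm br_add_right)
  also have "trace (\<lambda>v. (-1) \<cdot> (br a \<circ> br (E b)) v) = - killing a (E b)"
    unfolding trace_scale killing_def by (simp add: comp_def)
  finally show ?thesis .
qed

lemma killing_invariant: "killing (br x y) z = killing x (br y z)"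
proof -
  have "killing (br x y) z = - killing x (br z y)"
    unfolding killing_def[of "br x y"] by (intro trace_derivation_br endo_ad ad_derivation)
  also have "br z y = (-1) \<cdot> br y z"
    using br_anti[of z y] by simp
  finally show ?thesis by (simp only: killing_scale_right) simp
qed

text \<open>A nondegenerate form embeds a finite-dimensional space into its dual, so it reaches every functional.
The dual is modelled by the space itself: a functional is recorded as the vector whose
coordinates are its values on the basis.\<close>

lemma killing_represents:
  assumes nondeg: "\<forall>x. (\<forall>y. killing x y = 0) \<longrightarrow> x = 0"
    and phi: "\<And>x y. phi (x + y) = phi x + phi y" "\<And>c x. phi (c \<cdot> x) = c * phi x"
  shows "\<exists>d. \<forall>x. phi x = killing d x"
proof -
  have expand: "psi x = (\<Sum>b\<in>Basis. representation Basis x b * psi b)"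
    if "\<And>x y. psi (x + y) = psi x + psi y" "\<And>c x. psi (c \<cdot> x) = c * psi x" for psi :: "'v \<Rightarrow> 'a" and x
  proof -
    have psi0: "psi 0 = 0" using that(2)[of 0 0] by simp
    have s: "psi (sum g A) = (\<Sum>a\<in>A. psi (g a))" for g :: "'v \<Rightarrow> 'v" and A
      by (induction A rule: infinite_finite_induct) (auto simp: psi0 that(1))
    have "x = (\<Sum>b\<in>Basis. representation Basis x b \<cdot> b)"
      using finite_Basis independent_Basis span_Basis by (subst sum_representation_eq) auto
    then have "psi x = psi (\<Sum>b\<in>Basis. representation Basis x b \<cdot> b)" by simp
    then show ?thesis by (simp only: s that(2))
  qed
  have kexp: "killing d x = (\<Sum>b\<in>Basis. representation Basis x b * killing d b)" for d x
    by (rule expand[of "killing d"]) (simp_all add: killing_add_right killing_scale_right)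
  define F where "F d = (\<Sum>b\<in>Basis. killing d b \<cdot> b)" for d
  have F: "endo F"
    by (simp add: endo_iff F_def killing_add_left killing_scale_left scale_left_distrib
        sum.distrib scale_sum_right)
  have "d = 0" if "F d = 0" for d
  proof (rule nondeg[rule_format])
    fix y
    have "killing d b = 0" if "b \<in> Basis" for b
      using representation_sum_basis[OF that, of "killing d"] \<open>F d = 0\<close> by (simp add: F_def representation_zero)
    then show "killing d y = 0" by (subst kexp) simp
  qed
  then have "inj F"
    using F by (metis (no_types, lifting) endo_diff eq_iff_diff_eq_0 injI)
  then have "surj F"
    using F by (intro linear_inj_imp_surj)
  then obtain d where d: "F d = (\<Sum>b\<in>Basis. phi b \<cdot> b)" by (metis surjD)
  have "phi x = killing d x" for x
  proof -
    have "killing d b = phi b" if "b \<in> Basis" for b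
      using representation_sum_basis[OF that, of "killing d"] representation_sum_basis[OF that, of phi] d by (simp add: F_def)
    then show ?thesis
      using expand[of phi x, OF phi] kexp[of d x] by simp
  qed
  then show ?thesis by blast
qed

text \<open>Represent the functional \<open>x \<mapsto> tr (ad x \<circ> D)\<close> by \<open>d\<close>. The derivation \<open>E = D - ad d\<close> then satisfies
\<open>tr (ad x \<circ> E) = 0\<close> for all \<open>x\<close>, so \<open>E b\<close> is orthogonal to everything by
\<open>trace_derivation_br\<close>.\<close>

lemma derivation_inner:
  assumes nondeg: "\<forall>x. (\<forall>y. killing x y = 0) \<longrightarrow> x = 0" and D: "derivation D"
  shows "\<exists>d. \<forall>x. D x = br d x"
proof -
  have Dendo: "endo D" using D by (simp add: derivation_def)
  have "\<exists>d. \<forall>x. trace (br x \<circ> D) = killing d x"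
  proof (rule killing_represents[OF nondeg])
    show "trace (br (x + y) \<circ> D) = trace (br x \<circ> D) + trace (br y \<circ> D)" for x y
      by (simp add: br_add_left comp_def trace_add)
    show "trace (br (c \<cdot> x) \<circ> D) = c * trace (br x \<circ> D)" for c x
      by (simp add: br_scale_left comp_def trace_scale)
  qed
  then obtain d where d: "\<And>x. trace (br x \<circ> D) = killing d x" by blast
  define E where "E x = D x - br d x" for x
  have E: "derivation E"
    unfolding derivation_def
  proof (intro conjI allI)
    show "endo E"
      using endo_minus[OF Dendo endo_ad] by (simp add: E_def[abs_def])
    show "E (br x y) = br (E x) y + br x (E y)" for x y
      using D by (simp add: derivation_def E_def br_diff ad_derivation[of d x y])
  qed
  have tr0: "trace (br x \<circ> E) = 0" for x
  proof -
    have "br x \<circ> E = (\<lambda>v. (br x \<circ> D) v - (br x \<circ> br d) v)"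
      by (simp add: E_def[abs_def] br_diff comp_def)
    then have "trace (br x \<circ> E) = trace (br x \<circ> D) - killing x d"
      by (simp only: trace_diff killing_def)
    then show ?thesis by (simp add: d killing_commute)
  qed
  have "E b = 0" for b
  proof (rule nondeg[rule_format])
    fix a
    have "killing a (E b) = 0"
      using trace_derivation_br[of E b a] E tr0 by (simp add: derivation_def)
    then show "killing (E b) a = 0" by (simp add: killing_commute)
  qed
  then show ?thesis by (auto simp: E_def)
qed

section \<open>Engel's theorem\<close>

text \<open>\<open>A\<close> kills some nonzero vector of every nonzero invariant quotient \<open>W / U\<close>; avoiding
quotient spaces, the vector is represented by an element of \<open>W - U\<close>.\<close>

definition flag_nilpotent :: "'v set \<Rightarrow> bool"
  where "flag_nilpotent A \<longleftrightarrow> (\<forall>U W. subspace U \<longrightarrow> subspace W \<longrightarrow> U \<subset> W \<longrightarrow>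
    (\<forall>a\<in>A. \<forall>w\<in>W. br a w \<in> W) \<longrightarrow> (\<forall>a\<in>A. \<forall>u\<in>U. br a u \<in> U) \<longrightarrow>
    (\<exists>w\<in>W - U. \<forall>a\<in>A. br a w \<in> U))"

text \<open>The vectors of \<open>W\<close> that \<open>A\<close> sends into \<open>U\<close> are stable under \<open>ad x\<close>, because \<open>x\<close> normalises \<open>A\<close>.
Apply powers of \<open>ad x\<close> to one of them that is not in \<open>U\<close>: the last power outside \<open>U\<close> is the witness.\<close>

lemma flag_nilpotent_extend:
  assumes A: "flag_nilpotent A" and x: "\<And>a. a \<in> A \<Longrightarrow> br a x \<in> A"
    and nil: "\<And>v. \<exists>n. (br x ^^ n) v = 0"
  shows "flag_nilpotent (span (insert x A))"
  unfolding flag_nilpotent_def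
proof (intro allI impI)
  fix U W
  assume U: "subspace U" and W: "subspace W" and UW: "U \<subset> W"
    and SW: "\<forall>a\<in>span (insert x A). \<forall>w\<in>W. br a w \<in> W"
    and SU: "\<forall>a\<in>span (insert x A). \<forall>u\<in>U. br a u \<in> U"
  have ins: "x \<in> span (insert x A)" "\<And>a. a \<in> A \<Longrightarrow> a \<in> span (insert x A)"
    by (auto intro: span_base)
  obtain w where w: "w \<in> W - U" "\<forall>a\<in>A. br a w \<in> U"
    using A[unfolded flag_nilpotent_def, rule_format, OF U W UW] SW SU ins by auto
  have step: "br x v \<in> W \<and> (\<forall>a\<in>A. br a (br x v) \<in> U)"
    if v: "v \<in> W" "\<forall>a\<in>A. br a v \<in> U" for v
  proof (intro conjI ballI)
    show "br x v \<in> W" using SW ins v by blast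
    fix a assume a: "a \<in> A"
    have "br (br a x) v \<in> U" "br x (br a v) \<in> U" using x[OF a] v a SU ins by auto
    then show "br a (br x v) \<in> U"
      unfolding ad_derivation[of a x v] using U subspace_add by blast
  qed
  have pow: "(br x ^^ k) w \<in> W \<and> (\<forall>a\<in>A. br a ((br x ^^ k) w) \<in> U)" for k
    by (induction k) (use w step in auto)
  obtain n where "(br x ^^ n) w = 0" using nil by blast
  then have ex: "\<exists>n. (br x ^^ n) w \<in> U" using subspace_0[OF U] by metis
  define k where "k = (LEAST n. (br x ^^ n) w \<in> U)"
  have k: "(br x ^^ k) w \<in> U" unfolding k_def using LeastI_ex[OF ex] .
  with w have "k \<noteq> 0" by (auto intro: ccontr)
  then obtain j where j: "k = Suc j" by (cases k) auto
  define v where "v = (br x ^^ j) w"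
  have "v \<notin> U" unfolding v_def using not_less_Least[of j "\<lambda>n. (br x ^^ n) w \<in> U"] j k_def by auto
  moreover have "br x v \<in> U" using k j by (simp add: v_def)
  moreover have "v \<in> W" "\<forall>a\<in>A. br a v \<in> U" using pow[of j] by (auto simp: v_def)
  moreover have "subspace {a. br a v \<in> U}"
    using subspace_preimage_endo[OF endo_br_right U] .
  ultimately have "span (insert x A) \<subseteq> {a. br a v \<in> U}"
    by (intro span_minimal) auto
  then show "\<exists>w\<in>W - U. \<forall>a\<in>span (insert x A). br a w \<in> U"
    using \<open>v \<in> W\<close> \<open>v \<notin> U\<close> by blast
qed

text \<open>Take a flag-nilpotent subalgebra \<open>A\<close> of maximal dimension. If it were proper, the flag condition for
\<open>A\<close> inside the whole algebra would give an \<open>x\<close> outside \<open>A\<close> that normalises \<open>A\<close>, and adjoining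
\<open>x\<close> would enlarge \<open>A\<close>. So \<open>A\<close> is everything, and the flag condition for \<open>0\<close> inside the whole
algebra gives the central vector.\<close>

theorem engel_centre:
  assumes nil: "\<And>x v. \<exists>n. (br x ^^ n) v = 0" and nontrivial: "(v0 :: 'v) \<noteq> 0"
  obtains w where "w \<noteq> 0" "\<And>x. br x w = 0"
proof -
  let ?P = "\<lambda>A. subspace A \<and> (\<forall>a\<in>A. \<forall>b\<in>A. br a b \<in> A) \<and> flag_nilpotent A"
  have "?P {0}"
    using subspace_0 by (auto simp: flag_nilpotent_def)
  moreover have "\<forall>A. ?P A \<longrightarrow> dim A < Suc dimension"
    using dim_subset_UNIV by (simp add: less_Suc_eq_le)
  ultimately obtain A where A: "?P A" and max: "\<And>A'. ?P A' \<Longrightarrow> dim A' \<le> dim A"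
    using ex_has_greatest_nat[of ?P "{0}" dim "Suc dimension"] by auto
  have "A = UNIV"
  proof (rule ccontr)
    assume "A \<noteq> UNIV"
    then have "A \<subset> UNIV" by auto
    then obtain x where x: "x \<notin> A" "\<forall>a\<in>A. br a x \<in> A"
      using A unfolding flag_nilpotent_def by (metis Diff_iff UNIV_I subspace_UNIV)
    let ?A' = "span (insert x A)"
    have sub: "A \<subseteq> ?A'" "x \<in> ?A'" by (auto intro: span_base)
    have xA: "br x a \<in> A" if "a \<in> A" for a
      using x that A br_anti[of x a] subspace_neg by metis
    have "br a b \<in> A" if a: "a \<in> ?A'" and b: "b \<in> ?A'" for a b
    proof -
      have "insert x A \<subseteq> {b. br c b \<in> A}" if "c \<in> insert x A" for c
        using that x xA A br_alternating subspace_0 by auto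
      moreover have "subspace {b. br c b \<in> A}" for c
        using subspace_preimage_endo[OF endo_ad] A by simp
      ultimately have "insert x A \<subseteq> {c. br c b \<in> A}"
        using b span_minimal by blast
      moreover have "subspace {c. br c b \<in> A}"
        using subspace_preimage_endo[OF endo_br_right] A by simp
      ultimately show ?thesis using a span_minimal by blast
    qed
    then have "?P ?A'"
      using flag_nilpotent_extend[of A x] A x nil sub(1) by blast
    then have "dim ?A' \<le> dim A" by (rule max)
    moreover have "span A \<subset> span ?A'"
      using sub x A span_eq_iff[of A] by (auto simp only: span_span)
    then have "dim A < dim ?A'" by (rule dim_psubset)
    ultimately show False by simp
  qed
  then have "flag_nilpotent UNIV" using A by simp
  from this[unfolded flag_nilpotent_def, rule_format, of "{0}" UNIV]
  have "\<exists>w\<in>UNIV - {0}. \<forall>a\<in>UNIV. br a w \<in> {0}"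
    using nontrivial by auto
  then show ?thesis using that by auto
qed

end

section \<open>Complex Lie algebras with vanishing Killing form\<close>

locale complex_lie_algebra = lie_algebra_over scale Basis br
  for scale :: "complex \<Rightarrow> 'v::ab_group_add \<Rightarrow> 'v" (infixr \<open>\<cdot>\<close> 75)
    and Basis :: "'v set" and br :: "'v \<Rightarrow> 'v \<Rightarrow> 'v"
begin

lemma ad_spectral: "complex_endomorphism scale Basis (br x)"
  by unfold_locales (simp_all add: br_add_right br_scale_right)

text \<open>The derivation \<open>ad x\<close> satisfies
\<open>(ad x - l - m) [v, w] = [(ad x - l) v, w] + [v, (ad x - m) w]\<close>, which lowers one of the two exponents.\<close>

lemma br_gen_eigenspaces:
  assumes v: "v \<in> complex_endomorphism.gen_eigenspace scale (br x) l"
    and w: "w \<in> complex_endomorphism.gen_eigenspace scale (br x) m"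
  shows "br v w \<in> complex_endomorphism.gen_eigenspace scale (br x) (l + m)"
proof -
  interpret X: complex_endomorphism scale Basis "br x" by (rule ad_spectral)
  have leib: "X.shift (l + m) (br v w) = br (X.shift l v) w + br v (X.shift m w)" for v w
    unfolding X.shift_def ad_derivation[of x v w]
    by (simp add: br_diff br_scale_left br_scale_right algebra_simps)
  have "br v w \<in> X.gen_kernel (i + j) (l + m)"
    if "v \<in> X.gen_kernel i l" "w \<in> X.gen_kernel j m" for i j v w
    using that
  proof (induction "i + j" arbitrary: i j v w)
    case 0
    then show ?case by (auto simp: X.gen_kernel_0)
  next
    case (Suc n)
    show ?case
    proof (cases "i = 0 \<or> j = 0")
      case True
      then show ?thesis using Suc.prems X.subspace_gen_kernel subspace_0 
        by (auto simp: X.gen_kernel_0)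
    next
      case False
      then obtain i' j' where ij: "i = Suc i'" "j = Suc j'" by (meson not0_implies_Suc)
      have "br (X.shift l v) w \<in> X.gen_kernel (i' + j) (l + m)"
        using Suc ij by (intro Suc.hyps) (auto simp: X.gen_kernel_Suc)
      moreover have "br v (X.shift m w) \<in> X.gen_kernel (i + j') (l + m)"
        using Suc ij by (intro Suc.hyps) (auto simp: X.gen_kernel_Suc)
      ultimately have "X.shift (l + m) (br v w) \<in> X.gen_kernel n (l + m)"
        unfolding leib using Suc.hyps(2) ij X.subspace_gen_kernel subspace_add by simp
      then show ?thesis by (simp add: X.gen_kernel_Suc Suc.hyps(2)[symmetric])
    qed
  qed
  with v w show ?thesis unfolding X.gen_eigenspace_def by blast
qed

text \<open>The semisimple part of \<open>ad x\<close> with conjugated eigenvalues is a derivation \<open>E\<close>, since conjugation is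
additive. Its trace against \<open>ad x\<close> is \<open>\<Sum> \<bar>\<lambda>\<bar>\<^sup>2\<close>, and it is also a sum of values of the
Killing form.\<close>

theorem killing_zero_imp_ad_nilpotent:
  assumes zero: "\<And>a b. killing a b = 0" and x: "x \<in> span {br a b | a b. True}"
  shows "\<exists>n. (br x ^^ n) v = 0"
proof -
  interpret X: complex_endomorphism scale Basis "br x" by (rule ad_spectral)
  obtain B lam where B: "independent B" "span B = UNIV"
    and eig: "\<And>b. b \<in> B \<Longrightarrow> b \<in> X.gen_eigenspace (lam b)"
    and tri: "\<And>b. b \<in> B \<Longrightarrow> X.shift (lam b) b \<in> span (B - {b})"
    using X.triangular_eigenbasis by blast
  have finB: "finite B" using B by (simp add: finiteI_independent)
  define E where "E v = (\<Sum>b\<in>B. (representation B v b * cnj (lam b)) \<cdot> b)" for v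
  have endoE: "endo E"
    using B by (simp add: endo_iff E_def representation_add representation_scale
        scale_left_distrib sum.distrib scale_sum_right algebra_simps)
  have E_eig: "E v = cnj l \<cdot> v" if v: "v \<in> X.gen_eigenspace l" for v l
  proof -
    let ?r = "representation B v"
    have vsum: "v = (\<Sum>b\<in>B. ?r b \<cdot> b)" using B finB by (subst sum_representation_eq) auto
    let ?M = "insert l (lam ` B)"
    \<comment> \<open>For each eigenvalue \<open>m\<close>, the \<open>m\<close>-component of the expansion of \<open>v\<close> minus that of \<open>v\<close> itself;
      these add up to zero, so each of them vanishes.\<close>
    let ?part = "\<lambda>m. (\<Sum>b\<in>{b\<in>B. lam b = m}. ?r b \<cdot> b) - (if m = l then v else 0)"
    have part0: "?part m = 0" if "m \<in> ?M" for m
    proof (rule X.gen_eigenspaces_independent[of ?M ?part])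
      show "finite ?M" using finB by simp
      show "?part m \<in> X.gen_eigenspace m" for m
        using v eig by (intro subspace_diff subspace_sum subspace_scale X.subspace_gen_eigenspace)
          (auto intro: subspace_0 X.subspace_gen_eigenspace)
      have "(\<Sum>m\<in>?M. \<Sum>b\<in>{b\<in>B. lam b = m}. ?r b \<cdot> b) = (\<Sum>b\<in>B. ?r b \<cdot> b)"
        using finB by (intro sum.group) auto
      then show "(\<Sum>m\<in>?M. ?part m) = 0"
        using finB vsum by (simp add: sum_subtractf del: sum.insert)
    qed fact
    have "E v = (\<Sum>m\<in>?M. \<Sum>b\<in>{b\<in>B. lam b = m}. (?r b * cnj (lam b)) \<cdot> b)"
      unfolding E_def using finB by (intro sum.group[symmetric]) auto
    also have "\<dots> = (\<Sum>m\<in>?M. cnj m \<cdot> (\<Sum>b\<in>{b\<in>B. lam b = m}. ?r b \<cdot> b))"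
      by (intro sum.cong refl) (simp add: scale_sum_right mult.commute)
    also have "\<dots> = (\<Sum>m\<in>?M. cnj m \<cdot> (if m = l then v else 0))"
    proof (intro sum.cong refl)
      fix m assume "m \<in> ?M"
      from part0[OF this] show "cnj m \<cdot> (\<Sum>b\<in>{b\<in>B. lam b = m}. ?r b \<cdot> b)
          = cnj m \<cdot> (if m = l then v else 0)"
        by (simp only: right_minus_eq)
    qed
    also have "\<dots> = (\<Sum>m\<in>?M. if m = l then cnj m \<cdot> v else 0)"
      by (intro sum.cong) auto
    also have "\<dots> = cnj l \<cdot> v" using finB by (subst sum.delta) auto
    finally show ?thesis .
  qed
  have leib: "E (br v w) = br (E v) w + br v (E w)" for v w
  proof -
    have sv: "v \<in> span (\<Union>m. X.gen_eigenspace m)" and sw: "w \<in> span (\<Union>m. X.gen_eigenspace m)"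
      by (simp_all add: X.span_gen_eigenspaces)
    show ?thesis
      using sv
    proof (induction v rule: span_induct_alt)
      case base
      then show ?case by (simp add: endo_zero[OF endoE])
    next
      case (step c v y)
      note v = step(1)
      have "E (br v w) = br (E v) w + br v (E w)"
        using sw
      proof (induction w rule: span_induct_alt)
        case base
        then show ?case by (simp add: endo_zero[OF endoE])
      next
        case (step d w z)
        obtain l m where lm: "v \<in> X.gen_eigenspace l" "w \<in> X.gen_eigenspace m"
          using v step by auto
        have "E (br v w) = br (E v) w + br v (E w)"
          using E_eig[OF br_gen_eigenspaces[OF lm]] E_eig[OF lm(1)] E_eig[OF lm(2)]
          by (simp add: br_scale_left br_scale_right scale_left_distrib)
        with step show ?case
          by (simp add: br_add_right br_scale_right endo_add[OF endoE] endo_scale[OF endoE]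
              scale_right_distrib algebra_simps)
      qed
      with step show ?case
        by (simp add: br_add_left br_scale_left endo_add[OF endoE] endo_scale[OF endoE]
            scale_right_distrib algebra_simps)
    qed
  qed
  have "trace (br x \<circ> E) = 0"
    using x
  proof (induction x rule: span_induct_alt)
    case base
    show ?case by (simp add: comp_def basis_trace_def representation_zero)
  next
    case (step c y z)
    then have "trace (br y \<circ> E) = 0"
      using trace_derivation_br[OF endoE leib] zero by auto
    moreover have "br (c \<cdot> y + z) \<circ> E = (\<lambda>v. c \<cdot> (br y \<circ> E) v + (br z \<circ> E) v)"
      by (rule ext) (simp add: br_add_left br_scale_left)
    ultimately show ?case using step by (simp only: trace_add trace_scale) simp
  qed
  moreover have "trace (br x \<circ> E) = (\<Sum>b\<in>B. lam b * cnj (lam b))"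
  proof -
    have "representation B ((br x \<circ> E) b) b = lam b * cnj (lam b)" if b: "b \<in> B" for b
    proof -
      have "(br x \<circ> E) b = cnj (lam b) \<cdot> (X.shift (lam b) b + lam b \<cdot> b)"
        using E_eig[OF eig[OF b]] by (simp add: X.shift_def br_scale_right)
      moreover have "representation B (X.shift (lam b) b) b = 0"
        using tri[OF b] B by (intro representation_eq_zero_outside[of B "B - {b}"]) auto
      ultimately show ?thesis
        using B b by (simp add: representation_scale representation_add representation_basis)
    qed
    then show ?thesis
      using trace_eq_basis_trace[OF endo_comp[OF endo_ad endoE] B] by (simp add: basis_trace_def)
  qed
  ultimately have "(\<Sum>b\<in>B. complex_of_real ((cmod (lam b))\<^sup>2)) = 0"
    by (simp add: complex_norm_square del: of_real_power)
  then have "(\<Sum>b\<in>B. (cmod (lam b))\<^sup>2) = 0"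
    by (metis of_real_eq_0_iff of_real_sum)
  then have "\<forall>b\<in>B. lam b = 0" using finB by (simp add: sum_nonneg_eq_0_iff)
  then have "B \<subseteq> X.gen_eigenspace 0" using eig by (metis subsetI)
  then have "v \<in> X.gen_eigenspace 0"
    using B(2) X.subspace_gen_eigenspace span_minimal by blast
  then show ?thesis
    by (auto simp: X.gen_eigenspace_def X.gen_kernel_def X.shift_def[abs_def])
qed

end

section \<open>Complexification\<close>

text \<open>The pair \<open>(x, y)\<close> stands for \<open>x + \<i> y\<close> in the complexification.\<close>

definition complex_scale :: "complex \<Rightarrow> 'g \<times> 'g \<Rightarrow> 'g::real_vector \<times> 'g"
  where "complex_scale c X =
    (Re c *\<^sub>R fst X - Im c *\<^sub>R snd X, Re c *\<^sub>R snd X + Im c *\<^sub>R fst X)"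

definition complex_bracket :: "('g::real_vector \<Rightarrow> 'g \<Rightarrow> 'g) \<Rightarrow> 'g \<times> 'g \<Rightarrow> 'g \<times> 'g \<Rightarrow> 'g \<times> 'g"
  where "complex_bracket br X Y =
    (br (fst X) (fst Y) - br (snd X) (snd Y), br (fst X) (snd Y) + br (snd X) (fst Y))"

lemma complex_vector_space: "vector_space complex_scale"
  by unfold_locales (auto simp: complex_scale_def algebra_simps)

lemma complex_scale_sum_real_basis:
  "(\<Sum>b\<in>B. complex_scale (c b) (b, 0)) = (\<Sum>b\<in>B. Re (c b) *\<^sub>R b, \<Sum>b\<in>B. Im (c b) *\<^sub>R b)"
  by (simp add: complex_scale_def prod_eq_iff fst_sum snd_sum)

lemma complex_finite_dimensional:
  fixes B :: "'g::real_vector set"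
  assumes "finite B" "independent B" "span B = UNIV"
  shows "finite_dimensional_vector_space complex_scale ((\<lambda>b. (b, 0)) ` B)"
proof -
  interpret C: vector_space "complex_scale :: complex \<Rightarrow> 'g \<times> 'g \<Rightarrow> 'g \<times> 'g"
    by (rule complex_vector_space)
  let ?C = "(\<lambda>b. (b, 0 :: 'g)) ` B"
  have inj: "inj_on (\<lambda>b. (b, 0 :: 'g)) B" by (simp add: inj_on_def)
  show ?thesis
  proof
    show "finite ?C" using assms by simp
    show "\<not> C.dependent ?C"
    proof (rule C.independent_if_scalars_zero)
      fix f X assume f: "(\<Sum>x\<in>?C. complex_scale (f x) x) = 0" and X: "X \<in> ?C"
      then have *: "(\<Sum>b\<in>B. Re (f (b, 0)) *\<^sub>R b) = 0" "(\<Sum>b\<in>B. Im (f (b, 0)) *\<^sub>R b) = 0"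
        using complex_scale_sum_real_basis[of "\<lambda>b. f (b, 0)" B]
        by (simp_all add: sum.reindex[OF inj] zero_prod_def)
      obtain b where b: "b \<in> B" "X = (b, 0)" using X by auto
      have "Re (f (b, 0)) = 0" "Im (f (b, 0)) = 0"
        using independentD[OF assms(2,1) order_refl *(1) b(1)]
          independentD[OF assms(2,1) order_refl *(2) b(1)] by simp_all
      then show "f X = 0" by (simp add: b(2) complex_eq_iff)
    qed (use assms in simp)
    show "C.span ?C = UNIV"
    proof -
      have "(x, y) \<in> C.span ?C" for x y
      proof -
        have "(x, y) = (\<Sum>b\<in>B. complex_scale (Complex (representation B x b) (representation B y b)) (b, 0))"
          unfolding complex_scale_sum_real_basis
          using assms by (simp add: real_vector.sum_representation_eq)
        also have "\<dots> \<in> C.span ?C"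
          by (intro C.span_sum C.span_scale C.span_base) auto
        finally show ?thesis .
      qed
      then show ?thesis by auto
    qed
  qed
qed

section \<open>The Killing form of a simple real Lie algebra\<close>

context fin_dim_lie_algebra
begin

definition lie_basis :: "'g set"
  where "lie_basis = (SOME B. finite B \<and> independent B \<and> span B = UNIV)"

lemma lie_basis: "finite lie_basis" "independent lie_basis" "span lie_basis = UNIV"
proof -
  obtain S :: "'g set" where S: "finite S" "span S = UNIV" using finite_dim by blast
  obtain B where B: "B \<subseteq> S" "independent B" "S \<subseteq> span B"
    using real_vector.maximal_independent_subset by blast
  then have "span B = UNIV" using S(2) by (metis span_mono span_span top.extremum_uniqueI)
  then have "\<exists>B :: 'g set. finite B \<and> independent B \<and> span B = UNIV"
    using finite_subset[OF B(1) S(1)] B(2) by auto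
  from someI_ex[OF this] show "finite lie_basis" "independent lie_basis" "span lie_basis = UNIV"
    by (simp_all add: lie_basis_def)
qed

lemma linear_br: "linear (br x)" "linear (\<lambda>x. br x y)"
  using bilinear_br by (simp_all add: bilinear_def)

sublocale over: lie_algebra_over "(*\<^sub>R)" lie_basis br
proof
  show "\<not> module.dependent (*\<^sub>R) lie_basis" "module.span (*\<^sub>R) lie_basis = UNIV"
    using lie_basis by (simp_all flip: dependent_raw_def span_raw_def)
qed (use lie_basis br_self jacobi in
    \<open>simp_all add: linear_br[THEN linear_add] linear_br[THEN linear_scale]\<close>)

lemma linear_imp_endo: "linear f \<Longrightarrow> over.endo f"
  by (simp add: over.endo_iff linear_add linear_scale)

lemma killing_form_eq: "killing_form br = over.killing"
proof (intro ext)
  fix x y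
  have "killing_form br x y = (\<Sum>b\<in>lie_basis. representation lie_basis ((br x \<circ> br y) b) b)"
    unfolding killing_form_def using lie_basis linear_br
    by (intro lin_trace_eq linear_compose)
  then show "killing_form br x y = over.killing x y"
    by (simp add: over.killing_def over.basis_trace_def flip: representation_raw_def)
qed

lemma complexification: "complex_lie_algebra complex_scale ((\<lambda>b. (b, 0)) ` lie_basis) (complex_bracket br)"
proof -
  interpret C: finite_dimensional_vector_space complex_scale "(\<lambda>b. (b, 0 :: 'g)) ` lie_basis"
    using lie_basis by (rule complex_finite_dimensional)
  show ?thesis
  proof
    fix X Y Z :: "'g \<times> 'g" and c
    note simps = complex_bracket_def complex_scale_def over.br_add_left over.br_add_right
      over.br_diff over.br_scale_left over.br_scale_right
    show "complex_bracket br (X + Y) Z = complex_bracket br X Z + complex_bracket br Y Z"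
      "complex_bracket br Z (X + Y) = complex_bracket br Z X + complex_bracket br Z Y"
      by (simp_all add: simps)
    show "complex_bracket br (complex_scale c X) Y = complex_scale c (complex_bracket br X Y)"
      "complex_bracket br X (complex_scale c Y) = complex_scale c (complex_bracket br X Y)"
      by (simp_all add: simps algebra_simps)
    show "complex_bracket br X X = 0"
      using over.br_anti[of "fst X" "snd X"]
      by (simp add: simps over.br_alternating zero_prod_def)
    have j: "br a (br b c) = - br b (br c a) - br c (br a b)" for a b c
      using jacobi[of a b c] by (simp only: eq_diff_eq eq_neg_iff_add_eq_0) (simp only: ac_simps)
    show "complex_bracket br X (complex_bracket br Y Z) + complex_bracket br Y (complex_bracket br Z X)
        + complex_bracket br Z (complex_bracket br X Y) = 0"
      by (simp add: simps zero_prod_def j[of "fst X"] j[of "snd X"] algebra_simps)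
  qed
qed

text \<open>Both hypotheses pass to the complexification, whose Killing form is the complex bilinear
extension of the real one, and nilpotency of \<open>ad (x, 0)\<close> there restricts back.\<close>

theorem killing_form_zero_imp_ad_nilpotent:
  assumes zero: "\<And>a b. over.killing a b = 0" and x: "x \<in> span {br a b | a b. True}"
  shows "\<exists>n. (br x ^^ n) v = 0"
proof -
  interpret C: complex_lie_algebra complex_scale "(\<lambda>b. (b, 0 :: 'g)) ` lie_basis" "complex_bracket br"
    by (rule complexification)
  have inj: "inj_on (\<lambda>b. (b, 0 :: 'g)) lie_basis" by (simp add: inj_on_def)
  have real_ad: "complex_bracket br (a, 0) (p, q) = (br a p, br a q)" for a p q
    by (simp add: complex_bracket_def)
  have rep: "C.representation ((\<lambda>b. (b, 0)) ` lie_basis) (w, 0) (b, 0) = of_real (representation lie_basis w b)"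
    if "b \<in> lie_basis" for b w
  proof -
    have "w = (\<Sum>b\<in>lie_basis. representation lie_basis w b *\<^sub>R b)"
      using lie_basis by (simp add: real_vector.sum_representation_eq)
    then have "(w, 0) = (\<Sum>b\<in>lie_basis. complex_scale (of_real (representation lie_basis w b)) (b, 0))"
      unfolding complex_scale_sum_real_basis by simp
    also have "\<dots> = (\<Sum>X\<in>(\<lambda>b. (b, 0)) ` lie_basis.
        complex_scale (of_real (representation lie_basis w (fst X))) X)"
      by (simp add: sum.reindex[OF inj])
    finally have "(w, 0) = \<dots>" .
    then show ?thesis
      using C.representation_sum_basis[of "(b, 0)" "\<lambda>X. of_real (representation lie_basis w (fst X))"] that
      by simp
  qed
  have real_zero: "C.killing (a, 0) (b, 0) = 0" for a b
  proof -
    have "C.killing (a, 0) (b, 0)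
        = (\<Sum>e\<in>lie_basis. of_real (representation lie_basis ((br a \<circ> br b) e) e))"
      unfolding C.killing_def C.basis_trace_def sum.reindex[OF inj]
      by (intro sum.cong) (simp_all add: real_ad rep)
    also have "\<dots> = of_real (over.killing a b)"
      by (simp add: over.killing_def over.basis_trace_def flip: representation_raw_def)
    finally show ?thesis using zero by simp
  qed
  have split: "X = (fst X, 0) + complex_scale \<i> (snd X, 0)" for X :: "'g \<times> 'g"
    by (simp add: complex_scale_def prod_eq_iff)
  have "C.killing X Y = 0" for X Y
    by (subst split[of X], subst split[of Y])
      (simp add: C.killing_add_left C.killing_add_right C.killing_scale_left C.killing_scale_right
        real_zero del: split_pairs)
  moreover have "(x, 0) \<in> C.span {complex_bracket br A B | A B. True}"
    using x
  proof (induction rule: real_vector.span_induct_alt)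
    case base
    show ?case using C.span_zero by (simp add: zero_prod_def)
  next
    case (step c y z)
    then obtain a b where "y = br a b" by auto
    then have "(y, 0) = complex_bracket br (a, 0) (b, 0)" by (simp add: real_ad)
    then have "(y, 0) \<in> C.span {complex_bracket br A B | A B. True}"
      by (intro C.span_base) auto
    then have "complex_scale (of_real c) (y, 0) + (z, 0) \<in> C.span {complex_bracket br A B | A B. True}"
      using step by (intro C.span_add C.span_scale)
    moreover have "complex_scale (of_real c) (y, 0) + (z, 0) = (c *\<^sub>R y + z, 0)"
      by (simp add: complex_scale_def)
    ultimately show ?case by (simp only:)
  qed
  ultimately obtain n where n: "(complex_bracket br (x, 0) ^^ n) (v, 0) = 0"
    using C.killing_zero_imp_ad_nilpotent by blast
  have "(complex_bracket br (x, 0) ^^ k) (v, 0) = ((br x ^^ k) v, 0)" for k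
    by (induction k) (simp_all add: real_ad)
  with n show ?thesis by (auto simp: zero_prod_def)
qed

lemma simple_centre_trivial:
  assumes simple: "simple_lie_algebra br" and w: "\<And>x. br x w = 0"
  shows "w = 0"
proof -
  let ?Z = "{w. \<forall>x. br x w = 0}"
  have "lie_ideal br ?Z"
    by (simp add: lie_ideal_def subspace_def over.br_add_right over.br_scale_right)
  then have "?Z = {0} \<or> ?Z = UNIV" using simple by (simp add: simple_lie_algebra_def)
  moreover have "?Z \<noteq> UNIV" using simple by (auto simp: simple_lie_algebra_def)
  ultimately show ?thesis using w by blast
qed

lemma simple_perfect:
  assumes simple: "simple_lie_algebra br"
  shows "span {br a b | a b. True} = UNIV"
proof -
  let ?D = "span {br a b | a b. True}"
  have "lie_ideal br ?D"
    unfolding lie_ideal_def by (auto intro: span_base)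
  then have "?D = {0} \<or> ?D = UNIV" using simple by (simp add: simple_lie_algebra_def)
  moreover have "br a b \<in> ?D" for a b by (auto intro: span_base)
  ultimately show ?thesis using simple by (auto simp: simple_lie_algebra_def)
qed

text \<open>The radical of the Killing form is an ideal. If it were the whole algebra, every \<open>ad a\<close> would be
nilpotent, and Engel's theorem would produce a nonzero central element.\<close>

theorem simple_killing_nondegenerate:
  assumes simple: "simple_lie_algebra br" and x: "\<And>y. over.killing x y = 0"
  shows "x = 0"
proof -
  let ?R = "{x. \<forall>y. over.killing x y = 0}"
  have "over.killing (br u w) y = over.killing w (br y u)" for u w y
    using over.killing_invariant[of u w y] over.killing_invariant[of w y u]
      over.killing_commute[of u "br w y"] by simp
  then have "lie_ideal br ?R"
    by (simp add: lie_ideal_def subspace_def over.killing_zero over.killing_add_left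
        over.killing_scale_left)
  then consider "?R = {0}" | "?R = UNIV" using simple by (auto simp: simple_lie_algebra_def)
  then show ?thesis
  proof cases
    case 1
    then show ?thesis using x by blast
  next
    case 2
    then have zero: "over.killing a b = 0" for a b by auto
    have nil: "\<exists>n. (br a ^^ n) v = 0" for a v
      by (rule killing_form_zero_imp_ad_nilpotent[OF zero]) (simp only: simple_perfect[OF simple] UNIV_I)
    show ?thesis
    proof (rule ccontr)
      assume "x \<noteq> 0"
      then obtain w where "w \<noteq> 0" "\<And>a. br a w = 0"
        using over.engel_centre[OF nil] by blast
      then show False using simple_centre_trivial[OF simple] by blast
    qed
  qed
qed

end

section \<open>Simple symmetric couples\<close>

locale simple_couple = symmetric_couple br \<sigma>
  for br :: "'g::real_vector \<Rightarrow> 'g \<Rightarrow> 'g" and \<sigma> :: "'g \<Rightarrow> 'g" +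
  assumes simple: "simple_lie_algebra br"
begin

abbreviation K :: "'g set" where "K \<equiv> sym_K \<sigma>"
abbreviation P :: "'g set" where "P \<equiv> sym_P \<sigma>"
abbreviation pk :: "'g \<Rightarrow> 'g" where "pk x \<equiv> x - proj_P \<sigma> x"
abbreviation pp :: "'g \<Rightarrow> 'g" where "pp \<equiv> proj_P \<sigma>"

lemmas pk_K = canonical_decomposition(1)
lemmas pp_P = canonical_decomposition(2)

lemma sigma_add: "\<sigma> (x + y) = \<sigma> x + \<sigma> y"
  and sigma_scale: "\<sigma> (c *\<^sub>R x) = c *\<^sub>R \<sigma> x"
  using linear_sigma by (simp_all add: linear_add linear_scale)

lemma sigma_zero: "\<sigma> 0 = 0"
  using linear_sigma by (rule linear_0)

lemma subspace_K: "subspace K" and subspace_P: "subspace P"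
  by (simp_all add: subspace_def sym_K_def sym_P_def sigma_add sigma_scale sigma_zero)

lemma br_KK: "x \<in> K \<Longrightarrow> y \<in> K \<Longrightarrow> br x y \<in> K"
  and br_KP: "x \<in> K \<Longrightarrow> y \<in> P \<Longrightarrow> br x y \<in> P"
  and br_PK: "x \<in> P \<Longrightarrow> y \<in> K \<Longrightarrow> br x y \<in> P"
  and br_PP: "x \<in> P \<Longrightarrow> y \<in> P \<Longrightarrow> br x y \<in> K"
  by (simp_all add: sym_K_def sym_P_def sigma_br over.br_uminus)

lemma proj_of_K: "x \<in> K \<Longrightarrow> pp x = 0"
  by (simp add: proj_P_def sym_K_def)

lemma proj_of_P: "x \<in> P \<Longrightarrow> pp x = x"
  by (simp add: proj_P_def sym_P_def flip: scaleR_2)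

lemma proj_add: "pp (x + y) = pp x + pp y"
  and proj_scale: "pp (c *\<^sub>R x) = c *\<^sub>R pp x"
  by (simp_all add: proj_P_def sigma_add sigma_scale algebra_simps)

lemma KP_sum_zero:
  assumes "x + y = 0" "x \<in> P" "y \<in> K" shows "x = 0" "y = 0"
proof -
  have "pp (x + y) = x" using proj_of_P[OF assms(2)] proj_of_K[OF assms(3)] proj_add by simp
  then show "x = 0" using assms(1) proj_of_K[OF subspace_0[OF subspace_K]] by simp
  then show "y = 0" using assms(1) by simp
qed

text \<open>\<open>ad (\<sigma> x)\<close> is conjugate to \<open>ad x\<close> under \<open>\<sigma>\<close>.\<close>

lemma killing_sigma: "over.killing (\<sigma> x) (\<sigma> y) = over.killing x y"
proof -
  have s: "over.endo \<sigma>" using linear_sigma by (rule linear_imp_endo)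
  have conj: "br (\<sigma> x) = \<sigma> \<circ> br x \<circ> \<sigma>" for x
    by (rule ext) (simp add: sigma_br sigma_sigma)
  have "br (\<sigma> x) \<circ> br (\<sigma> y) = (\<sigma> \<circ> br x \<circ> br y) \<circ> \<sigma>"
    unfolding conj by (rule ext) (simp add: sigma_sigma)
  then have "over.killing (\<sigma> x) (\<sigma> y) = over.trace ((\<sigma> \<circ> br x \<circ> br y) \<circ> \<sigma>)"
    by (simp add: over.killing_def)
  also have "\<dots> = over.trace (\<sigma> \<circ> (\<sigma> \<circ> br x \<circ> br y))"
    by (intro over.trace_comp_commute over.endo_comp over.endo_ad s)
  also have "\<sigma> \<circ> (\<sigma> \<circ> br x \<circ> br y) = br x \<circ> br y"
    by (rule ext) (simp add: sigma_sigma)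
  finally show ?thesis by (simp only: over.killing_def)
qed

lemma killing_uminus: "over.killing (- x) y = - over.killing x y"
  "over.killing x (- y) = - over.killing x y"
  using over.killing_scale_left[of "-1" x y] over.killing_scale_right[of x "-1" y] by simp_all

lemma killing_KP: "x \<in> K \<Longrightarrow> y \<in> P \<Longrightarrow> over.killing x y = 0"
  using killing_sigma[of x y] by (simp add: sym_K_def sym_P_def killing_uminus)

lemma killing_nondegenerate: "(\<And>y. over.killing x y = 0) \<Longrightarrow> x = 0"
  using simple_killing_nondegenerate[OF simple] by blast

lemma killing_zero_if_zero_on_P:
  assumes "x \<in> P" "\<And>y. y \<in> P \<Longrightarrow> over.killing x y = 0"
  shows "x = 0"
proof (rule killing_nondegenerate)
  fix v
  have "over.killing x v = over.killing x (pk v) + over.killing x (pp v)"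
    by (simp flip: over.killing_add_right)
  then show "over.killing x v = 0"
    using assms pk_K pp_P killing_KP over.killing_commute by (metis add_0)
qed

lemma centre_trivial: "(\<And>y. br w y = 0) \<Longrightarrow> w = 0"
  using simple_centre_trivial[OF simple, of w] over.br_anti[of _ w] by simp

section \<open>Central elements of \<open>K\<close> act injectively on \<open>P\<close>\<close>

context
  fixes z assumes z: "z \<in> lie_centre br K"
begin

abbreviation S :: "'g \<Rightarrow> 'g" where "S x \<equiv> br z (br z x)"

lemma central_in_K: "z \<in> K"
  using z by (simp add: lie_centre_def)

lemma central_K: "k \<in> K \<Longrightarrow> br z k = 0"
  using z by (simp add: lie_centre_def)

lemma central_commute: "k \<in> K \<Longrightarrow> br z (br k x) = br k (br z x)"
  using over.ad_derivation[of z k x] central_K by simp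

lemma central_skew: "x \<in> P \<Longrightarrow> y \<in> P \<Longrightarrow> br (br z x) y = - br x (br z y)"
  using over.ad_derivation[of z x y] central_K[OF br_PP] by (simp add: eq_neg_iff_add_eq_0)

lemma central_P: "x \<in> P \<Longrightarrow> br z x \<in> P"
  using br_KP central_in_K by blast

lemma S_P: "x \<in> P \<Longrightarrow> S x \<in> P"
  by (intro central_P)

lemma S_commute: "k \<in> K \<Longrightarrow> S (br k x) = br k (S x)"
  by (simp add: central_commute)

lemma S_symmetric: "x \<in> P \<Longrightarrow> y \<in> P \<Longrightarrow> br (S x) y = br x (S y)"
  using central_skew[of "br z x" y] central_skew[of x "br z y"] central_P by simp

text \<open>Let \<open>U(x, y, w)\<close> be the defect \<open>[[S x, y], w] - S [[x, y], w]\<close>. The Bianchi identity gives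
\<open>U(x, y, w) = - U(w, x, y)\<close>; after three cyclic shifts \<open>U = - U\<close>.\<close>

lemma S_curvature:
  assumes x: "x \<in> P" and y: "y \<in> P" and w: "w \<in> P"
  shows "br (br (S x) y) w = br (br x y) (S w)"
proof -
  define U where "U x y w = br (br (S x) y) w - S (br (br x y) w)" for x y w
  have bianchi: "br (br a b) c = - br (br b c) a - br (br c a) b" for a b c
    using over.jacobi_left[of a b c]
    by (simp only: eq_diff_eq eq_neg_iff_add_eq_0) (simp only: ac_simps)
  have cyc: "U a b c = - U c a b" if "a \<in> P" "b \<in> P" "c \<in> P" for a b c
  proof -
    have "br (br (S a) b) c = - br (br b c) (S a) - br (br c (S a)) b"
      by (rule bianchi)
    also have "br (br b c) (S a) = S (br (br b c) a)"
      using S_commute[OF br_PP] that by simp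
    also have "br c (S a) = br (S c) a"
      using S_symmetric that by simp
    finally have "br (br (S a) b) c = - S (br (br b c) a) - br (br (S c) a) b" .
    moreover have "S (br (br a b) c) = - S (br (br b c) a) - S (br (br c a) b)"
      by (subst bianchi) (simp add: over.br_diff over.br_uminus)
    ultimately show ?thesis by (simp add: U_def)
  qed
  have "U x y w = - U w x y" "U w x y = - U y w x" "U y w x = - U x y w"
    using assms by (auto intro: cyc)
  then have "U x y w = - U x y w" by simp
  then have "2 *\<^sub>R U x y w = 0" by (simp add: scaleR_2 eq_neg_iff_add_eq_0)
  then have "U x y w = 0" by simp
  then show ?thesis
    using S_commute[OF br_PP[OF x y], of w] by (simp add: U_def)
qed

definition annihilator :: "'g set"
  where "annihilator = {v. \<forall>w\<in>P. br v (S w) = 0}"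

lemma annihilator_components:
  assumes "v \<in> annihilator" "w \<in> P"
  shows "br (pk v) (S w) = 0" "br (pp v) (S w) = 0"
proof -
  have "br (pk v) (S w) + br (pp v) (S w) = 0"
    using assms by (simp add: annihilator_def flip: over.br_add_left)
  moreover have "br (pk v) (S w) \<in> P" by (intro br_KP pk_K S_P assms)
  moreover have "br (pp v) (S w) \<in> K" by (intro br_PP pp_P S_P assms)
  ultimately show "br (pk v) (S w) = 0" "br (pp v) (S w) = 0" using KP_sum_zero by blast+
qed

text \<open>Split both factors into their \<open>K\<close>- and \<open>P\<close>-components. Only the product of two elements of \<open>P\<close> needs the
curvature identity; the others follow from the symmetry of \<open>S\<close> and its commuting with \<open>K\<close>.\<close>

lemma annihilator_ideal: "lie_ideal br annihilator"
  unfolding lie_ideal_def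
proof (intro conjI allI ballI)
  show "subspace annihilator"
    by (simp add: subspace_def annihilator_def over.br_add_left over.br_scale_left)
  fix u v assume v: "v \<in> annihilator"
  define k p l x where "k = pk u" and "p = pp u" and "l = pk v" and "x = pp v"
  have mem: "k \<in> K" "p \<in> P" "l \<in> K" "x \<in> P"
    unfolding k_def p_def l_def x_def by (rule pk_K pp_P)+
  have l: "br l (S w) = 0" and x: "br x (S w) = 0" if "w \<in> P" for w
    using annihilator_components[OF v that] by (simp_all add: l_def x_def)
  have expand: "br (br a b) c = br a (br b c) - br b (br a c)" for a b c
    using over.ad_derivation[of a b c] by simp
  show "br u v \<in> annihilator"
    unfolding annihilator_def
  proof (intro CollectI ballI)
    fix w assume w: "w \<in> P"
    have kw: "br k (S w) = S (br k w)" "br k w \<in> P"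
      using S_commute[OF mem(1)] br_KP[OF mem(1) w] by simp_all
    have "br (br k l) (S w) = 0" "br (br k x) (S w) = 0"
      unfolding expand kw(1) by (simp_all add: l x w kw(2))
    moreover have "br (br p l) (S w) = 0"
    proof -
      have "br p l \<in> P" using mem by (intro br_PK)
      then have "br (br p l) (S w) = br (S (br p l)) w"
        using S_symmetric w by simp
      also have "S (br p l) = - br l (S p)"
        using S_commute[OF mem(3), of p] over.br_anti[of p l] by (simp add: over.br_uminus)
      finally show ?thesis by (simp add: l mem)
    qed
    moreover have "br (br p x) (S w) = 0"
    proof -
      have "br (br p x) (S w) = br (br (S p) x) w"
        using S_curvature mem w by simp
      also have "br (S p) x = - br x (S p)" by (rule over.br_anti)
      finally show ?thesis by (simp add: x mem)
    qed
    moreover have "br u v = br k l + br k x + (br p l + br p x)"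
    proof -
      have "br u v = br (k + p) (l + x)" by (simp add: k_def p_def l_def x_def)
      then show ?thesis by (simp only: over.br_add_left over.br_add_right) (simp add: ac_simps)
    qed
    ultimately show "br (br u v) (S w) = 0" by (simp add: over.br_add_left)
  qed
qed

text \<open>An \<open>x\<close> in \<open>P\<close> killed by \<open>z\<close> satisfies \<open>[x, S w] = [S x, w] = 0\<close>, so it lies in the annihilator, an
ideal. If that ideal is everything, all \<open>S w\<close> are central, so \<open>(ad z)\<^sup>2 = 0\<close> and \<open>z\<close> is in the
radical of the Killing form.\<close>

lemma central_injective:
  assumes "z \<noteq> 0" "x \<in> P" "br z x = 0"
  shows "x = 0"
proof -
  consider "annihilator = {0}" | "annihilator = UNIV"
    using annihilator_ideal simple by (auto simp: simple_lie_algebra_def)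
  then show ?thesis
  proof cases
    case 1
    have "x \<in> annihilator"
      using S_symmetric[OF assms(2)] assms(3) by (simp add: annihilator_def flip: S_symmetric)
    with 1 show ?thesis by simp
  next
    case 2
    have SP: "S w = 0" if "w \<in> P" for w
    proof (rule centre_trivial)
      fix y
      have "br y (S w) = 0" using 2 that by (auto simp: annihilator_def)
      then show "br (S w) y = 0" using over.br_anti[of "S w" y] by simp
    qed
    have S0: "S v = 0" for v
    proof -
      have "S v = S (pk v) + S (pp v)" by (simp flip: over.br_add_right)
      then show ?thesis using SP[OF pp_P] central_K[OF pk_K] by simp
    qed
    have "over.killing z k = 0" if "k \<in> K" for k
      unfolding over.killing_def
    proof (rule over.trace_square_zero)
      show "over.endo (br z \<circ> br k)" by (intro over.endo_comp over.endo_ad)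
      show "(br z \<circ> br k) ((br z \<circ> br k) v) = 0" for v
        using central_commute[OF that] S0 by simp
    qed
    moreover have "over.killing z p = 0" if "p \<in> P" for p
      using killing_KP central_in_K that by blast
    ultimately have "over.killing z v = 0" for v
      using over.killing_add_right[of z "pk v" "pp v"] pk_K[of v] pp_P[of v] by simp
    then have "z = 0" by (rule killing_nondegenerate)
    with assms(1) show ?thesis by simp
  qed
qed

end

section \<open>From central elements to symplectic forms\<close>

lemma underline_eq: "underline_form br X Y Z = - over.killing X (br Y Z)"
  by (simp add: underline_form_def killing_form_eq)

lemma underline_swap: "underline_form br X Y Z = - over.killing (br X Y) Z"
  by (simp add: underline_eq over.killing_invariant)

lemma underline_antisym: "underline_form br X Y Z = - underline_form br X Z Y"
  unfolding underline_eq over.br_anti[of Y Z] killing_uminus by simp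

lemma underline_cocycle: "underline_form br X \<in> two_cocycles br"
proof -
  have "bilinear (underline_form br X)"
    unfolding bilinear_def
    by (auto intro!: linearI simp: underline_eq over.br_add_left over.br_add_right
        over.br_scale_left over.br_scale_right over.killing_add_right over.killing_scale_right)
  moreover have "underline_form br X (br A B) C + underline_form br X (br B C) A
      + underline_form br X (br C A) B = 0" for A B C
  proof -
    have "over.killing X (br (br A B) C + br (br B C) A + br (br C A) B) = 0"
      by (simp add: over.jacobi_left over.killing_zero)
    then show ?thesis
      by (simp add: underline_eq over.killing_add_right)
  qed
  ultimately show ?thesis
    by (simp add: two_cocycles_def underline_eq over.br_alternating over.killing_zero)
qed

text \<open>Invariance turns equality of the forms into \<open>\<beta>([X - Y, A], B) = 0\<close> for all \<open>A\<close> and \<open>B\<close>, so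
\<open>X - Y\<close> is central.\<close>

lemma underline_inj: "underline_form br X = underline_form br Y \<Longrightarrow> X = Y"
proof -
  assume eq: "underline_form br X = underline_form br Y"
  have "br (X - Y) A = 0" for A
  proof (rule killing_nondegenerate)
    fix B
    have "over.killing (br X A) B = over.killing (br Y A) B"
      using fun_cong[OF fun_cong[OF eq, of A], of B] by (simp add: underline_swap)
    then show "over.killing (br (X - Y) A) B = 0"
      by (simp add: over.br_diff over.killing_diff_left)
  qed
  then have "X - Y = 0" by (rule centre_trivial)
  then show "X = Y" by simp
qed

text \<open>Since \<open>z\<close> kills \<open>K\<close>, the value \<open>- \<beta>([z, X], Y)\<close> depends only on the \<open>P\<close>-component of \<open>X\<close>, and by
antisymmetry only on that of \<open>Y\<close>.\<close>

lemma underline_central_extends: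
  assumes z: "z \<in> lie_centre br K"
  shows "underline_form br z = extend_form \<sigma> (underline_form br z)"
proof (intro ext)
  fix X Y
  have zX: "br z X = br z (pp X)" for X
    using central_K[OF z pk_K[of X]] over.br_diff(2)[of z X "pp X"] by simp
  have "underline_form br z X Y = underline_form br z (pp X) Y"
    by (simp only: underline_swap zX[of X])
  also have "\<dots> = - underline_form br z Y (pp X)" by (rule underline_antisym)
  also have "\<dots> = - underline_form br z (pp Y) (pp X)"
    by (simp only: underline_swap zX[of Y])
  also have "\<dots> = underline_form br z (pp X) (pp Y)" by (rule underline_antisym[symmetric])
  finally show "underline_form br z X Y = extend_form \<sigma> (underline_form br z) X Y"
    by (simp add: extend_form_def)
qed

lemma underline_central_symplectic:
  assumes z: "z \<in> lie_centre br K" "z \<noteq> 0"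
  shows "underline_form br z \<in> invariant_symplectic_forms br \<sigma>"
proof -
  have "bilinear_form_on P (underline_form br z)"
    by (simp add: bilinear_form_on_def underline_eq over.br_add_left over.br_add_right
        over.br_scale_left over.br_scale_right over.killing_add_right over.killing_scale_right)
  moreover have "x = 0" if x: "x \<in> P" and deg: "\<forall>y\<in>P. underline_form br z x y = 0" for x
  proof (rule central_injective[OF z x])
    show "br z x = 0"
      using deg central_P[OF z(1) x] by (intro killing_zero_if_zero_on_P) (auto simp: underline_swap)
  qed
  moreover have "underline_form br z (br k x) y + underline_form br z x (br k y) = 0"
    if "k \<in> K" for k x y
  proof -
    have "over.killing z (br k (br x y)) = 0"
      using central_K[OF z(1) that] over.killing_invariant[of z k "br x y"]
      by (simp add: over.killing_zero)
    then show ?thesis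
      by (simp add: underline_eq over.ad_derivation[of k x y] over.killing_add_right)
  qed
  ultimately show ?thesis
    by (simp add: invariant_symplectic_forms_def symplectic_form_on_def invariant_form_on_def
        underline_eq over.br_alternating over.killing_zero)
qed

section \<open>From symplectic forms to central elements\<close>

lemma P_nonzero: "\<exists>x\<in>P. x \<noteq> 0"
proof (rule ccontr)
  assume "\<not> ?thesis"
  then have P0: "\<And>x. x \<in> P \<Longrightarrow> x = 0" by auto
  have "x = 0" for x :: 'g
  proof -
    have "br (pk x) y = 0" if "y \<in> P" for y
      using P0[OF that] by simp
    then have "pk x = 0" using faithful[OF pk_K] by blast
    then show "x = 0" using P0[OF pp_P[of x]] by simp
  qed
  then show False using simple by (auto simp: simple_lie_algebra_def)
qed

text \<open>By antisymmetry and invariance, \<open>\<Omega>([k, y], w)\<close> is symmetric in \<open>y\<close> and \<open>w\<close>. The bracket of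
two elements of \<open>P\<close> has no \<open>P\<close>-component, so the cocycle sum consists of differences of such terms, which cancel in pairs.\<close>

lemma extend_form_cocycle:
  assumes "\<Omega> \<in> invariant_symplectic_forms br \<sigma>"
  defines "\<omega> \<equiv> extend_form \<sigma> \<Omega>"
  shows "\<omega> (X + X') Y = \<omega> X Y + \<omega> X' Y" "\<omega> X (Y + Y') = \<omega> X Y + \<omega> X Y'"
    "\<omega> (c *\<^sub>R X) Y = c * \<omega> X Y" "\<omega> X (c *\<^sub>R Y) = c * \<omega> X Y"
    "\<omega> X Y = - \<omega> Y X" "\<omega> (br X Y) Z + \<omega> (br Y Z) X + \<omega> (br Z X) Y = 0"
proof -
  have add: "\<Omega> (x + y) w = \<Omega> x w + \<Omega> y w" "\<Omega> w (x + y) = \<Omega> w x + \<Omega> w y"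
    if "x \<in> P" "y \<in> P" "w \<in> P" for x y w
    using assms(1) that
    by (simp_all add: invariant_symplectic_forms_def symplectic_form_on_def bilinear_form_on_def)
  have scale: "\<Omega> (c *\<^sub>R x) y = c * \<Omega> x y" "\<Omega> x (c *\<^sub>R y) = c * \<Omega> x y"
    if "x \<in> P" "y \<in> P" for x y c
    using assms(1) that
    by (simp_all add: invariant_symplectic_forms_def symplectic_form_on_def bilinear_form_on_def)
  have alt: "\<Omega> x x = 0" if "x \<in> P" for x
    using assms(1) that by (simp add: invariant_symplectic_forms_def symplectic_form_on_def)
  have inv: "\<Omega> (br k x) y + \<Omega> x (br k y) = 0" if "k \<in> K" "x \<in> P" "y \<in> P" for k x y
    using assms(1) that by (simp add: invariant_symplectic_forms_def invariant_form_on_def)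
  have anti: "\<Omega> x y = - \<Omega> y x" if "x \<in> P" "y \<in> P" for x y
  proof -
    have "\<Omega> (x + y) (x + y) = 0" using that by (intro alt subspace_add subspace_P)
    moreover have "\<Omega> (x + y) (x + y) = \<Omega> x x + \<Omega> x y + (\<Omega> y x + \<Omega> y y)"
      using that subspace_add[OF subspace_P that] by (simp add: add)
    ultimately show ?thesis using alt that by simp
  qed
  show "\<omega> (X + X') Y = \<omega> X Y + \<omega> X' Y" "\<omega> X (Y + Y') = \<omega> X Y + \<omega> X Y'"
    "\<omega> (c *\<^sub>R X) Y = c * \<omega> X Y" "\<omega> X (c *\<^sub>R Y) = c * \<omega> X Y"
    by (simp_all add: \<omega>_def extend_form_def proj_add proj_scale add scale pp_P)
  show "\<omega> X Y = - \<omega> Y X"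
    using anti[OF pp_P pp_P, of X Y] by (simp add: \<omega>_def extend_form_def)
  have proj_br: "pp (br X Y) = br (pk X) (pp Y) + - br (pk Y) (pp X)" for X Y
  proof -
    have "br X Y = br (pk X + pp X) (pk Y + pp Y)" by simp
    also have "\<dots> = br (pk X) (pk Y) + br (pk X) (pp Y) + (br (pp X) (pk Y) + br (pp X) (pp Y))"
      by (simp only: over.br_add_left over.br_add_right ac_simps)
    finally have "pp (br X Y) = br (pk X) (pp Y) + br (pp X) (pk Y)"
      by (simp only: proj_add proj_of_K[OF br_KK[OF pk_K pk_K]] proj_of_K[OF br_PP[OF pp_P pp_P]]
          proj_of_P[OF br_KP[OF pk_K pp_P]] proj_of_P[OF br_PK[OF pp_P pk_K]]) simp
    also have "br (pp X) (pk Y) = - br (pk Y) (pp X)" by (rule over.br_anti)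
    finally show ?thesis .
  qed
  have neg: "\<Omega> (- x) y = - \<Omega> x y" if "x \<in> P" "y \<in> P" for x y
    using scale(1)[OF that, of "-1"] by simp
  have w: "\<omega> (br X Y) Z = \<Omega> (br (pk X) (pp Y)) (pp Z) - \<Omega> (br (pk Y) (pp X)) (pp Z)" for X Y Z
    unfolding \<omega>_def extend_form_def proj_br
      add(1)[OF br_KP[OF pk_K pp_P] subspace_neg[OF subspace_P br_KP[OF pk_K pp_P]] pp_P]
      neg[OF br_KP[OF pk_K pp_P] pp_P]
    by simp
  have i: "\<Omega> (br (pk A) (pp B)) (pp C) = \<Omega> (br (pk A) (pp C)) (pp B)" for A B C
    using inv[OF pk_K pp_P pp_P, of A B C] anti[OF pp_P br_KP[OF pk_K pp_P], of B A C] by simp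
  show "\<omega> (br X Y) Z + \<omega> (br Y Z) X + \<omega> (br Z X) Y = 0"
    unfolding w using i[of X Y Z] i[of Y Z X] i[of Z X Y] by simp
qed

text \<open>Nondegeneracy of \<open>\<beta>\<close> writes the extended form as \<open>\<beta>(D X, Y)\<close>; the cocycle identity makes \<open>D\<close> a
derivation, hence \<open>D = ad d\<close>. On \<open>P \<times> P\<close> only the \<open>K\<close>-component of \<open>d\<close> contributes, because
\<open>[P, P]\<close> lies in \<open>K\<close>, which is orthogonal to \<open>P\<close>.\<close>

lemma symplectic_form_from_centre:
  assumes \<Omega>: "\<Omega> \<in> invariant_symplectic_forms br \<sigma>"
  shows "\<exists>z\<in>lie_centre br K - {0}. underline_form br z = extend_form \<sigma> \<Omega>"
proof -
  define \<omega> where "\<omega> = extend_form \<sigma> \<Omega>"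
  note cocycle = extend_form_cocycle[OF \<Omega>, folded \<omega>_def]
  have nondeg: "\<forall>x. (\<forall>y. over.killing x y = 0) \<longrightarrow> x = 0"
    using killing_nondegenerate by blast
  have "\<exists>d. \<forall>Y. \<omega> X Y = over.killing d Y" for X
    by (rule over.killing_represents[OF nondeg]) (simp_all add: cocycle(2,4))
  then obtain D where D: "\<And>X Y. \<omega> X Y = over.killing (D X) Y" by metis
  have eqI: "A = B" if "\<And>W. over.killing A W = over.killing B W" for A B
  proof -
    have "A - B = 0"
      by (rule killing_nondegenerate) (simp add: over.killing_diff_left that)
    then show ?thesis by simp
  qed
  have "over.derivation D"
    unfolding over.derivation_def over.endo_iff
  proof (intro conjI allI)
    show "D (X + Y) = D X + D Y" for X Y
      by (rule eqI) (simp add: over.killing_add_left cocycle(1) flip: D)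
    show "D (c *\<^sub>R X) = c *\<^sub>R D X" for c X
      by (rule eqI) (simp add: over.killing_scale_left cocycle(3) flip: D)
    show "D (br X Y) = br (D X) Y + br X (D Y)" for X Y
    proof (rule eqI)
      fix W
      have "over.killing (br (D X) Y) W = \<omega> X (br Y W)"
        by (simp add: over.killing_invariant D)
      moreover have "over.killing (br X (D Y)) W = - \<omega> Y (br X W)"
        using over.br_anti[of X "D Y"] by (simp add: killing_uminus over.killing_invariant D)
      moreover have "\<omega> X (br Y W) = - \<omega> (br Y W) X" by (rule cocycle)
      moreover have "\<omega> Y (br X W) = \<omega> (br W X) Y"
        using cocycle(5)[of Y "br X W"] cocycle(3)[of "-1" "br W X" Y] over.br_anti[of X W] by simp
      ultimately show "over.killing (D (br X Y)) W = over.killing (br (D X) Y + br X (D Y)) W"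
        using cocycle(6)[of X Y W] by (simp add: over.killing_add_left flip: D)
    qed
  qed
  then obtain d where d: "\<And>X. D X = br d X"
    using over.derivation_inner[OF nondeg] by blast
  have zero_K: "br (pk d) k = 0" if k: "k \<in> K" for k
  proof -
    have "\<omega> k Y = 0" for Y
      using cocycle(3)[of 0 0 Y] proj_of_K[OF k] proj_of_K[OF subspace_0[OF subspace_K]]
      by (simp add: \<omega>_def extend_form_def)
    then have "br d k = 0"
      using D d killing_nondegenerate by simp
    then have "br (pp d) k + br (pk d) k = 0"
      by (simp flip: over.br_add_left)
    then show ?thesis
      using KP_sum_zero br_PK[OF pp_P k] br_KK[OF pk_K k] by blast
  qed
  \<comment> \<open>The sign compensates the one in the definition of the two-form attached to an element.\<close>
  define z where "z = - pk d"
  have z: "z \<in> lie_centre br K"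
    unfolding lie_centre_def
  proof (intro CollectI conjI ballI)
    show "z \<in> K" unfolding z_def by (rule subspace_neg[OF subspace_K pk_K])
    show "br z k = 0" if "k \<in> K" for k
      unfolding z_def over.br_uminus zero_K[OF that] by simp
  qed
  have onP: "underline_form br z X Y = \<Omega> X Y" if "X \<in> P" "Y \<in> P" for X Y
  proof -
    have "\<Omega> X Y = \<omega> X Y" using that by (simp add: \<omega>_def extend_form_def proj_of_P)
    also have "\<dots> = over.killing d (br X Y)" by (simp add: D d over.killing_invariant)
    also have "\<dots> = over.killing (pk d) (br X Y) + over.killing (pp d) (br X Y)"
      by (simp flip: over.killing_add_left)
    also have "over.killing (pp d) (br X Y) = 0"
      using killing_KP[OF br_PP[OF that] pp_P] over.killing_commute by metis
    finally show ?thesis unfolding underline_eq z_def killing_uminus by simp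
  qed
  have "underline_form br z = extend_form \<sigma> \<Omega>"
    by (subst underline_central_extends[OF z]) (intro ext, simp add: extend_form_def onP pp_P)
  moreover have "z \<noteq> 0"
  proof
    assume "z = 0"
    then have "\<forall>x\<in>P. \<forall>y\<in>P. \<Omega> x y = 0"
      using onP by (simp add: underline_eq over.killing_zero)
    then show False
      using P_nonzero \<Omega> unfolding invariant_symplectic_forms_def symplectic_form_on_def by blast
  qed
  ultimately show ?thesis using z by blast
qed

end

theorem theorem3p1p8:
  fixes br :: "'g::real_vector \<Rightarrow> 'g \<Rightarrow> 'g" and \<sigma> :: "'g \<Rightarrow> 'g"
  assumes "simple_symmetric_couple br \<sigma>"
  shows "underline_form br ` (lie_centre br (sym_K \<sigma>) - {0}) \<subseteq> two_cocycles br \<and>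
    bij_betw (underline_form br)
      (lie_centre br (sym_K \<sigma>) - {0})
      (extend_form \<sigma> ` invariant_symplectic_forms br \<sigma>)"
proof -
  interpret simple_couple br \<sigma>
    using assms by (simp add: simple_symmetric_couple_def simple_couple_def simple_couple_axioms_def)
  have "inj_on (underline_form br) (lie_centre br (sym_K \<sigma>) - {0})"
    by (rule inj_onI) (rule underline_inj)
  moreover have "underline_form br ` (lie_centre br (sym_K \<sigma>) - {0})
      = extend_form \<sigma> ` invariant_symplectic_forms br \<sigma>"
  proof (intro equalityI subsetI)
    fix w assume "w \<in> underline_form br ` (lie_centre br (sym_K \<sigma>) - {0})"
    then show "w \<in> extend_form \<sigma> ` invariant_symplectic_forms br \<sigma>"
      using underline_central_extends underline_central_symplectic by blast
  next
    fix w assume "w \<in> extend_form \<sigma> ` invariant_symplectic_forms br \<sigma>"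
    then obtain \<Omega> where \<Omega>: "\<Omega> \<in> invariant_symplectic_forms br \<sigma>" "w = extend_form \<sigma> \<Omega>"
      by blast
    from symplectic_form_from_centre[OF \<Omega>(1)] \<Omega>(2)
    show "w \<in> underline_form br ` (lie_centre br (sym_K \<sigma>) - {0})"
      by force
  qed
  ultimately show ?thesis
    using underline_cocycle unfolding bij_betw_def by blast
qed

end
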